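(* Let $k$ be a field, $B$ a Hopf algebra over $k$ (not necessarily finite-dimensional) with bijective antipode, and $H$ a braided Hopf algebra in the Yetter–Drinfeld category $({}^B_B\mathcal{YD},C)$. Let $\lambda$ be a non-zero integral on the bosonization $H\#B$, and let $a\in H$, $b\in B$ be such that $\lambda(a\otimes b)\neq0$. Then the linear functional $\lambda(\mathrm{id}\otimes b):H\to k$, $h\mapsto\lambda(h\otimes b)$, is a non-zero integral on $H$.
   Context: ${}^B_B\mathcal{YD}$: left $B$-modules and left $B$-comodules $M$ with $\sum(b\cdot m)_{(-1)}\otimes(b\cdot m)_{(0)}=\sum b_1m_{(-1)}S(b_3)\otimes b_2\cdot m_{(0)}$, with braiding $C(u\otimes v)=\sum u_{(-1)}\cdot v\otimes u_{(0)}$. A braided Hopf algebra is a Hopf algebra object in this category. The bosonization $H\#B$ is the ordinary Hopf algebra on $H\otimes B$ with product $(h\otimes b)(h'\otimes b')=\sum h(b_1\cdot h')\otimes b_2b'$ and coproduct $\Delta(h\otimes b)=\sum(h_1\otimes h_{2(-1)}b_1)\otimes(h_{2(0)}\otimes b_2)$. An integral on $A$ (for $A=H$ or $A=H\#B$) is an element of $\int^l_{A^*}=\{f\in A^*\mid g*f=g(1)f\text{ for all }g\in A^*\}$, where $A^*=\mathrm{Hom}_k(A,k)$ and $(g*f)(x)=\sum g(x_1)f(x_2)$. *)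

theory Defs
  imports "HOL-Algebra.Module" "HOL-Algebra.AbelCoset"
begin

text \<open>
  Vector spaces over a field \<open>K\<close> are represented as \<open>module K\<close>. The record type \<open>module\<close> extends \<open>ring\<close>; for a bare vector space its fields
  \<open>mult\<close> and \<open>one\<close> carry no information.
\<close>

section \<open>Linear maps and tensor products\<close>

definition linear_map ::
    "('k, 'z) ring_scheme \<Rightarrow> ('k, 'm, 'p) module_scheme \<Rightarrow> ('k, 'n, 'q) module_scheme \<Rightarrow> ('m \<Rightarrow> 'n) \<Rightarrow> bool"
  where "linear_map K M N f \<longleftrightarrow>
    f \<in> carrier M \<rightarrow> carrier N \<and>
    (\<forall>x\<in>carrier M. \<forall>y\<in>carrier M. f (x \<oplus>\<^bsub>M\<^esub> y) = f x \<oplus>\<^bsub>N\<^esub> f y) \<and>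
    (\<forall>c\<in>carrier K. \<forall>x\<in>carrier M. f (c \<odot>\<^bsub>M\<^esub> x) = c \<odot>\<^bsub>N\<^esub> f x)"

definition bilinear_map ::
    "('k, 'z) ring_scheme \<Rightarrow> ('k, 'm, 'p) module_scheme \<Rightarrow> ('k, 'n, 'q) module_scheme \<Rightarrow>
     ('k, 'l, 'r) module_scheme \<Rightarrow> ('m \<Rightarrow> 'n \<Rightarrow> 'l) \<Rightarrow> bool"
  where "bilinear_map K M N P \<beta> \<longleftrightarrow>
    (\<forall>x\<in>carrier M. linear_map K N P (\<beta> x)) \<and>
    (\<forall>y\<in>carrier N. linear_map K M P (\<lambda>x. \<beta> x y))"

text \<open>The field as a vector space over itself.\<close>

definition base_module :: "('k, 'z) ring_scheme \<Rightarrow> ('k, 'k) module"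
  where "base_module K =
    \<lparr>carrier = carrier K, mult = mult K, one = one K, zero = zero K, add = add K, smult = mult K\<rparr>"

definition free_module :: "('k, 'z) ring_scheme \<Rightarrow> 'x set \<Rightarrow> ('k, 'x \<Rightarrow> 'k) module"
  where "free_module K X =
    \<lparr>carrier = {f. (\<forall>x. f x \<in> carrier K) \<and> (\<forall>x. x \<notin> X \<longrightarrow> f x = \<zero>\<^bsub>K\<^esub>) \<and> finite {x. f x \<noteq> \<zero>\<^bsub>K\<^esub>}},
     mult = undefined, one = undefined,
     zero = (\<lambda>_. \<zero>\<^bsub>K\<^esub>),
     add = (\<lambda>f g x. f x \<oplus>\<^bsub>K\<^esub> g x),
     smult = (\<lambda>c f x. c \<otimes>\<^bsub>K\<^esub> f x)\<rparr>"

definition free_basis :: "('k, 'z) ring_scheme \<Rightarrow> 'x \<Rightarrow> 'x \<Rightarrow> 'k"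
  where "free_basis K x = (\<lambda>y. if y = x then \<one>\<^bsub>K\<^esub> else \<zero>\<^bsub>K\<^esub>)"

definition submodule_span :: "('k, 'z) ring_scheme \<Rightarrow> ('k, 'm, 'p) module_scheme \<Rightarrow> 'm set \<Rightarrow> 'm set"
  where "submodule_span K M A = \<Inter> {S. submodule S K M \<and> A \<subseteq> S}"

definition quotient_module ::
    "('k, 'z) ring_scheme \<Rightarrow> ('k, 'm, 'p) module_scheme \<Rightarrow> 'm set \<Rightarrow> ('k, 'm set) module"
  where "quotient_module K M S =
    \<lparr>carrier = a_rcosets\<^bsub>M\<^esub> S,
     mult = undefined, one = undefined,
     zero = S,
     add = set_add M,
     smult = (\<lambda>c X. \<Union>x\<in>X. S +>\<^bsub>M\<^esub> (c \<odot>\<^bsub>M\<^esub> x))\<rparr>"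

text \<open>The tensor product \<open>M \<otimes> N\<close> over \<open>K\<close>: the free module on the pairs, modulo bilinearity.\<close>

definition tensor_relations ::
    "('k, 'z) ring_scheme \<Rightarrow> ('k, 'm, 'p) module_scheme \<Rightarrow> ('k, 'n, 'q) module_scheme \<Rightarrow> ('m \<times> 'n \<Rightarrow> 'k) set"
  where "tensor_relations K M N =
    (let F = free_module K (carrier M \<times> carrier N); e = (\<lambda>m n. free_basis K (m, n)) in
      {e (m \<oplus>\<^bsub>M\<^esub> m') n \<ominus>\<^bsub>F\<^esub> (e m n \<oplus>\<^bsub>F\<^esub> e m' n) | m m' n.
          m \<in> carrier M \<and> m' \<in> carrier M \<and> n \<in> carrier N} \<union>
      {e m (n \<oplus>\<^bsub>N\<^esub> n') \<ominus>\<^bsub>F\<^esub> (e m n \<oplus>\<^bsub>F\<^esub> e m n') | m n n'.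
          m \<in> carrier M \<and> n \<in> carrier N \<and> n' \<in> carrier N} \<union>
      {e (c \<odot>\<^bsub>M\<^esub> m) n \<ominus>\<^bsub>F\<^esub> (c \<odot>\<^bsub>F\<^esub> e m n) | c m n.
          c \<in> carrier K \<and> m \<in> carrier M \<and> n \<in> carrier N} \<union>
      {e m (c \<odot>\<^bsub>N\<^esub> n) \<ominus>\<^bsub>F\<^esub> (c \<odot>\<^bsub>F\<^esub> e m n) | c m n.
          c \<in> carrier K \<and> m \<in> carrier M \<and> n \<in> carrier N})"

definition tensor_kernel ::
    "('k, 'z) ring_scheme \<Rightarrow> ('k, 'm, 'p) module_scheme \<Rightarrow> ('k, 'n, 'q) module_scheme \<Rightarrow> ('m \<times> 'n \<Rightarrow> 'k) set"
  where "tensor_kernel K M N =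
    submodule_span K (free_module K (carrier M \<times> carrier N)) (tensor_relations K M N)"

definition tensor ::
    "('k, 'z) ring_scheme \<Rightarrow> ('k, 'm, 'p) module_scheme \<Rightarrow> ('k, 'n, 'q) module_scheme \<Rightarrow>
     ('k, ('m \<times> 'n \<Rightarrow> 'k) set) module"
  where "tensor K M N =
    quotient_module K (free_module K (carrier M \<times> carrier N)) (tensor_kernel K M N)"

definition tens ::
    "('k, 'z) ring_scheme \<Rightarrow> ('k, 'm, 'p) module_scheme \<Rightarrow> ('k, 'n, 'q) module_scheme \<Rightarrow>
     'm \<Rightarrow> 'n \<Rightarrow> ('m \<times> 'n \<Rightarrow> 'k) set"
  where "tens K M N m n =
    tensor_kernel K M N +>\<^bsub>free_module K (carrier M \<times> carrier N)\<^esub> free_basis K (m, n)"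

text \<open>
  The linear map \<open>M \<otimes> N \<rightarrow> P\<close> induced by a bilinear map \<open>\<beta>\<close>, computed on a representative in the
  free module; for bilinear \<open>\<beta>\<close> the choice does not matter. It plays the role of Sweedler sums:
  \<open>tensor_lift K P (\<lambda>x\<^sub>1 x\<^sub>2. \<beta> x\<^sub>1 x\<^sub>2) (\<Delta> x)\<close> is \<open>\<Sum> \<beta> x\<^sub>1 x\<^sub>2\<close>, where \<open>P\<close> is the space
  containing the values.
\<close>

definition tensor_lift ::
    "('k, 'z) ring_scheme \<Rightarrow> ('k, 'l, 'r) module_scheme \<Rightarrow> ('m \<Rightarrow> 'n \<Rightarrow> 'l) \<Rightarrow> ('m \<times> 'n \<Rightarrow> 'k) set \<Rightarrow> 'l"
  where "tensor_lift K P \<beta> t =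
    (let x = (SOME x. x \<in> t) in
      \<Oplus>\<^bsub>P\<^esub>p \<in> {p. x p \<noteq> \<zero>\<^bsub>K\<^esub>}. x p \<odot>\<^bsub>P\<^esub> \<beta> (fst p) (snd p))"


section \<open>Algebras, coalgebras, Hopf algebras\<close>

record ('k, 'a) bialg = "('k, 'a) module" +
  comult :: "'a \<Rightarrow> ('a \<times> 'a \<Rightarrow> 'k) set"
  counit :: "'a \<Rightarrow> 'k"

text \<open>The library locale \<open>algebra\<close> only covers commutative algebras.\<close>

definition assoc_algebra :: "('k, 'z) ring_scheme \<Rightarrow> ('k, 'a, 'p) module_scheme \<Rightarrow> bool"
  where "assoc_algebra K A \<longleftrightarrow>
    module K A \<and> ring A \<and> bilinear_map K A A A (mult A)"

definition coalgebra :: "('k, 'z) ring_scheme \<Rightarrow> ('k, 'a, 'p) bialg_scheme \<Rightarrow> bool"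
  where "coalgebra K C \<longleftrightarrow>
    module K C \<and>
    linear_map K C (tensor K C C) (comult C) \<and>
    linear_map K C (base_module K) (counit C) \<and>
    (\<forall>x\<in>carrier C.
      (let P = tensor K C (tensor K C C);
           tens3 = (\<lambda>u v w. tens K C (tensor K C C) u (tens K C C v w)) in
        tensor_lift K P (\<lambda>u v. tensor_lift K P (\<lambda>u\<^sub>1 u\<^sub>2. tens3 u\<^sub>1 u\<^sub>2 v) (comult C u)) (comult C x) =
        tensor_lift K P (\<lambda>u v. tensor_lift K P (\<lambda>v\<^sub>1 v\<^sub>2. tens3 u v\<^sub>1 v\<^sub>2) (comult C v)) (comult C x))) \<and>
    (\<forall>x\<in>carrier C. tensor_lift K C (\<lambda>x\<^sub>1 x\<^sub>2. counit C x\<^sub>1 \<odot>\<^bsub>C\<^esub> x\<^sub>2) (comult C x) = x) \<and>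
    (\<forall>x\<in>carrier C. tensor_lift K C (\<lambda>x\<^sub>1 x\<^sub>2. counit C x\<^sub>2 \<odot>\<^bsub>C\<^esub> x\<^sub>1) (comult C x) = x)"

definition bialgebra :: "('k, 'z) ring_scheme \<Rightarrow> ('k, 'a, 'p) bialg_scheme \<Rightarrow> bool"
  where "bialgebra K B \<longleftrightarrow>
    assoc_algebra K B \<and> coalgebra K B \<and>
    (\<forall>x\<in>carrier B. \<forall>y\<in>carrier B.
      comult B (x \<otimes>\<^bsub>B\<^esub> y) =
        tensor_lift K (tensor K B B) (\<lambda>x\<^sub>1 x\<^sub>2.
          tensor_lift K (tensor K B B) (\<lambda>y\<^sub>1 y\<^sub>2. tens K B B (x\<^sub>1 \<otimes>\<^bsub>B\<^esub> y\<^sub>1) (x\<^sub>2 \<otimes>\<^bsub>B\<^esub> y\<^sub>2))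
            (comult B y)) (comult B x)) \<and>
    comult B \<one>\<^bsub>B\<^esub> = tens K B B \<one>\<^bsub>B\<^esub> \<one>\<^bsub>B\<^esub> \<and>
    (\<forall>x\<in>carrier B. \<forall>y\<in>carrier B. counit B (x \<otimes>\<^bsub>B\<^esub> y) = counit B x \<otimes>\<^bsub>K\<^esub> counit B y) \<and>
    counit B \<one>\<^bsub>B\<^esub> = \<one>\<^bsub>K\<^esub>"

definition antipode :: "('k, 'z) ring_scheme \<Rightarrow> ('k, 'a, 'p) bialg_scheme \<Rightarrow> ('a \<Rightarrow> 'a) \<Rightarrow> bool"
  where "antipode K A S \<longleftrightarrow>
    linear_map K A A S \<and>
    (\<forall>x\<in>carrier A.
      tensor_lift K A (\<lambda>x\<^sub>1 x\<^sub>2. S x\<^sub>1 \<otimes>\<^bsub>A\<^esub> x\<^sub>2) (comult A x) = counit A x \<odot>\<^bsub>A\<^esub> \<one>\<^bsub>A\<^esub> \<and>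
      tensor_lift K A (\<lambda>x\<^sub>1 x\<^sub>2. x\<^sub>1 \<otimes>\<^bsub>A\<^esub> S x\<^sub>2) (comult A x) = counit A x \<odot>\<^bsub>A\<^esub> \<one>\<^bsub>A\<^esub>)"

definition hopf_algebra :: "('k, 'z) ring_scheme \<Rightarrow> ('k, 'a, 'p) bialg_scheme \<Rightarrow> ('a \<Rightarrow> 'a) \<Rightarrow> bool"
  where "hopf_algebra K B S \<longleftrightarrow> bialgebra K B \<and> antipode K B S"


section \<open>Left-left Yetter-Drinfeld modules\<close>

record ('k, 'b, 'm) yd_structure =
  act :: "'b \<Rightarrow> 'm \<Rightarrow> 'm"
  coact :: "'m \<Rightarrow> ('b \<times> 'm \<Rightarrow> 'k) set"

definition left_module_over ::
    "('k, 'z) ring_scheme \<Rightarrow> ('k, 'b, 'p) bialg_scheme \<Rightarrow> ('k, 'm, 'q) module_scheme \<Rightarrow>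
     ('b \<Rightarrow> 'm \<Rightarrow> 'm) \<Rightarrow> bool"
  where "left_module_over K B M \<alpha> \<longleftrightarrow>
    bilinear_map K B M M \<alpha> \<and>
    (\<forall>m\<in>carrier M. \<alpha> \<one>\<^bsub>B\<^esub> m = m) \<and>
    (\<forall>b\<in>carrier B. \<forall>b'\<in>carrier B. \<forall>m\<in>carrier M. \<alpha> (b \<otimes>\<^bsub>B\<^esub> b') m = \<alpha> b (\<alpha> b' m))"

definition left_comodule_over ::
    "('k, 'z) ring_scheme \<Rightarrow> ('k, 'b, 'p) bialg_scheme \<Rightarrow> ('k, 'm, 'q) module_scheme \<Rightarrow>
     ('m \<Rightarrow> ('b \<times> 'm \<Rightarrow> 'k) set) \<Rightarrow> bool"
  where "left_comodule_over K B M \<rho> \<longleftrightarrow>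
    linear_map K M (tensor K B M) \<rho> \<and>
    (\<forall>m\<in>carrier M.
      (let P = tensor K B (tensor K B M);
           tens3 = (\<lambda>u v w. tens K B (tensor K B M) u (tens K B M v w)) in
        tensor_lift K P (\<lambda>u n. tensor_lift K P (\<lambda>u\<^sub>1 u\<^sub>2. tens3 u\<^sub>1 u\<^sub>2 n) (comult B u)) (\<rho> m) =
        tensor_lift K P (\<lambda>u n. tensor_lift K P (\<lambda>u' n'. tens3 u u' n') (\<rho> n)) (\<rho> m))) \<and>
    (\<forall>m\<in>carrier M. tensor_lift K M (\<lambda>u n. counit B u \<odot>\<^bsub>M\<^esub> n) (\<rho> m) = m)"

definition yd_module ::
    "('k, 'z) ring_scheme \<Rightarrow> ('k, 'b, 'p) bialg_scheme \<Rightarrow> ('b \<Rightarrow> 'b) \<Rightarrow>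
     ('k, 'm, 'q) module_scheme \<Rightarrow> ('k, 'b, 'm) yd_structure \<Rightarrow> bool"
  where "yd_module K B S M Y \<longleftrightarrow>
    module K M \<and> left_module_over K B M (act Y) \<and> left_comodule_over K B M (coact Y) \<and>
    (\<forall>b\<in>carrier B. \<forall>m\<in>carrier M.
      (let P = tensor K B M in
        coact Y (act Y b m) =
          tensor_lift K P (\<lambda>b\<^sub>1 b'.
            tensor_lift K P (\<lambda>b\<^sub>2 b\<^sub>3.
              tensor_lift K P (\<lambda>u n. tens K B M (b\<^sub>1 \<otimes>\<^bsub>B\<^esub> u \<otimes>\<^bsub>B\<^esub> S b\<^sub>3) (act Y b\<^sub>2 n))
                (coact Y m)) (comult B b')) (comult B b)))"

definition yd_morphism ::
    "('k, 'z) ring_scheme \<Rightarrow> ('k, 'b, 'p) bialg_scheme \<Rightarrow>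
     ('k, 'm, 'q) module_scheme \<Rightarrow> ('k, 'b, 'm) yd_structure \<Rightarrow>
     ('k, 'n, 'r) module_scheme \<Rightarrow> ('k, 'b, 'n) yd_structure \<Rightarrow> ('m \<Rightarrow> 'n) \<Rightarrow> bool"
  where "yd_morphism K B M Y N Z f \<longleftrightarrow>
    linear_map K M N f \<and>
    (\<forall>b\<in>carrier B. \<forall>m\<in>carrier M. f (act Y b m) = act Z b (f m)) \<and>
    (\<forall>m\<in>carrier M.
      coact Z (f m) = tensor_lift K (tensor K B N) (\<lambda>u n. tens K B N u (f n)) (coact Y m))"

text \<open>The monoidal structure: diagonal action and codiagonal coaction on \<open>M \<otimes> N\<close>; the unit is \<open>K\<close>.\<close>

definition yd_tensor ::
    "('k, 'z) ring_scheme \<Rightarrow> ('k, 'b, 'p) bialg_scheme \<Rightarrow>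
     ('k, 'm, 'q) module_scheme \<Rightarrow> ('k, 'b, 'm) yd_structure \<Rightarrow>
     ('k, 'n, 'r) module_scheme \<Rightarrow> ('k, 'b, 'n) yd_structure \<Rightarrow>
     ('k, 'b, ('m \<times> 'n \<Rightarrow> 'k) set) yd_structure"
  where "yd_tensor K B M Y N Z =
    (let T = tensor K M N; P = tensor K B T in
    \<lparr>act = (\<lambda>b. tensor_lift K T (\<lambda>m n.
        tensor_lift K T (\<lambda>b\<^sub>1 b\<^sub>2. tens K M N (act Y b\<^sub>1 m) (act Z b\<^sub>2 n)) (comult B b))),
     coact = tensor_lift K P (\<lambda>m n.
        tensor_lift K P (\<lambda>u m\<^sub>0.
          tensor_lift K P (\<lambda>v n\<^sub>0. tens K B T (u \<otimes>\<^bsub>B\<^esub> v) (tens K M N m\<^sub>0 n\<^sub>0))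
            (coact Z n)) (coact Y m))\<rparr>)"

definition yd_unit ::
    "('k, 'z) ring_scheme \<Rightarrow> ('k, 'b, 'p) bialg_scheme \<Rightarrow> ('k, 'b, 'k) yd_structure"
  where "yd_unit K B =
    \<lparr>act = (\<lambda>b c. counit B b \<otimes>\<^bsub>K\<^esub> c),
     coact = (\<lambda>c. tens K B (base_module K) \<one>\<^bsub>B\<^esub> c)\<rparr>"

definition yd_braiding ::
    "('k, 'z) ring_scheme \<Rightarrow> ('k, 'm, 'q) module_scheme \<Rightarrow> ('k, 'b, 'm) yd_structure \<Rightarrow>
     ('k, 'n, 'r) module_scheme \<Rightarrow> ('k, 'b, 'n) yd_structure \<Rightarrow>
     ('m \<times> 'n \<Rightarrow> 'k) set \<Rightarrow> ('n \<times> 'm \<Rightarrow> 'k) set"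
  where "yd_braiding K M Y N Z =
    tensor_lift K (tensor K N M) (\<lambda>u v.
      tensor_lift K (tensor K N M) (\<lambda>u' u\<^sub>0. tens K N M (act Z u' v) u\<^sub>0) (coact Y u))"


section \<open>Braided Hopf algebras and bosonization\<close>

text \<open>
  A Hopf algebra object in the Yetter-Drinfeld category of \<open>B\<close>: all structure maps are morphisms of
  that category, and the comultiplication is multiplicative for the product
  \<open>(mult \<otimes> mult) \<circ> (id \<otimes> C \<otimes> id)\<close> on \<open>H \<otimes> H\<close>, with \<open>C\<close> the braiding.
\<close>

definition braided_bialgebra ::
    "('k, 'z) ring_scheme \<Rightarrow> ('k, 'b, 'p) bialg_scheme \<Rightarrow> ('b \<Rightarrow> 'b) \<Rightarrow>
     ('k, 'h, 'q) bialg_scheme \<Rightarrow> ('k, 'b, 'h) yd_structure \<Rightarrow> bool"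
  where "braided_bialgebra K B S H Y \<longleftrightarrow>
    (let T = tensor K H H; YT = yd_tensor K B H Y H Y; U = base_module K; YU = yd_unit K B in
    yd_module K B S H Y \<and> assoc_algebra K H \<and> coalgebra K H \<and>
    yd_morphism K B T YT H Y (tensor_lift K H (mult H)) \<and>
    yd_morphism K B U YU H Y (\<lambda>c. c \<odot>\<^bsub>H\<^esub> \<one>\<^bsub>H\<^esub>) \<and>
    yd_morphism K B H Y T YT (comult H) \<and>
    yd_morphism K B H Y U YU (counit H) \<and>
    (\<forall>x\<in>carrier H. \<forall>y\<in>carrier H.
      comult H (x \<otimes>\<^bsub>H\<^esub> y) =
        tensor_lift K T (\<lambda>x\<^sub>1 x\<^sub>2.
          tensor_lift K T (\<lambda>y\<^sub>1 y\<^sub>2.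
            tensor_lift K T (\<lambda>v u. tens K H H (x\<^sub>1 \<otimes>\<^bsub>H\<^esub> v) (u \<otimes>\<^bsub>H\<^esub> y\<^sub>2))
              (yd_braiding K H Y H Y (tens K H H x\<^sub>2 y\<^sub>1))) (comult H y)) (comult H x)) \<and>
    comult H \<one>\<^bsub>H\<^esub> = tens K H H \<one>\<^bsub>H\<^esub> \<one>\<^bsub>H\<^esub> \<and>
    (\<forall>x\<in>carrier H. \<forall>y\<in>carrier H. counit H (x \<otimes>\<^bsub>H\<^esub> y) = counit H x \<otimes>\<^bsub>K\<^esub> counit H y) \<and>
    counit H \<one>\<^bsub>H\<^esub> = \<one>\<^bsub>K\<^esub>)"

definition braided_hopf_algebra ::
    "('k, 'z) ring_scheme \<Rightarrow> ('k, 'b, 'p) bialg_scheme \<Rightarrow> ('b \<Rightarrow> 'b) \<Rightarrow>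
     ('k, 'h, 'q) bialg_scheme \<Rightarrow> ('k, 'b, 'h) yd_structure \<Rightarrow> bool"
  where "braided_hopf_algebra K B S H Y \<longleftrightarrow>
    braided_bialgebra K B S H Y \<and>
    (\<exists>S\<^sub>H. antipode K H S\<^sub>H \<and> yd_morphism K B H Y H Y S\<^sub>H)"

definition bosonization ::
    "('k, 'z) ring_scheme \<Rightarrow> ('k, 'h, 'q) bialg_scheme \<Rightarrow> ('k, 'b, 'h) yd_structure \<Rightarrow>
     ('k, 'b, 'p) bialg_scheme \<Rightarrow> ('k, ('h \<times> 'b \<Rightarrow> 'k) set) bialg"
  where "bosonization K H Y B =
    (let T = tensor K H B; P = tensor K T T in
    \<lparr>carrier = carrier T,
     mult = (\<lambda>s t.
       tensor_lift K T (\<lambda>h b.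
         tensor_lift K T (\<lambda>h' b'.
           tensor_lift K T (\<lambda>b\<^sub>1 b\<^sub>2. tens K H B (h \<otimes>\<^bsub>H\<^esub> act Y b\<^sub>1 h') (b\<^sub>2 \<otimes>\<^bsub>B\<^esub> b'))
             (comult B b)) t) s),
     one = tens K H B \<one>\<^bsub>H\<^esub> \<one>\<^bsub>B\<^esub>,
     zero = zero T,
     add = add T,
     smult = smult T,
     comult = tensor_lift K P (\<lambda>h b.
       tensor_lift K P (\<lambda>h\<^sub>1 h\<^sub>2.
         tensor_lift K P (\<lambda>u h\<^sub>2\<^sub>0.
           tensor_lift K P (\<lambda>b\<^sub>1 b\<^sub>2. tens K T T (tens K H B h\<^sub>1 (u \<otimes>\<^bsub>B\<^esub> b\<^sub>1)) (tens K H B h\<^sub>2\<^sub>0 b\<^sub>2))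
             (comult B b)) (coact Y h\<^sub>2)) (comult H h)),
     counit = tensor_lift K (base_module K) (\<lambda>h b. counit H h \<otimes>\<^bsub>K\<^esub> counit B b)\<rparr>)"


section \<open>Integrals\<close>

text \<open>Functionals are restricted to the carrier, so that equality in \<open>A\<^sup>*\<close> is equality of functions.\<close>

definition dual_space :: "('k, 'z) ring_scheme \<Rightarrow> ('k, 'a, 'p) module_scheme \<Rightarrow> ('a \<Rightarrow> 'k) set"
  where "dual_space K A = {f \<in> extensional (carrier A). linear_map K A (base_module K) f}"

definition zero_functional :: "('k, 'z) ring_scheme \<Rightarrow> ('k, 'a, 'p) module_scheme \<Rightarrow> 'a \<Rightarrow> 'k"
  where "zero_functional K A = (\<lambda>x\<in>carrier A. \<zero>\<^bsub>K\<^esub>)"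

definition convolution ::
    "('k, 'z) ring_scheme \<Rightarrow> ('k, 'a, 'p) bialg_scheme \<Rightarrow> ('a \<Rightarrow> 'k) \<Rightarrow> ('a \<Rightarrow> 'k) \<Rightarrow> 'a \<Rightarrow> 'k"
  where "convolution K A g f =
    (\<lambda>x\<in>carrier A. tensor_lift K (base_module K) (\<lambda>x\<^sub>1 x\<^sub>2. g x\<^sub>1 \<otimes>\<^bsub>K\<^esub> f x\<^sub>2) (comult A x))"

definition left_integrals :: "('k, 'z) ring_scheme \<Rightarrow> ('k, 'a, 'p) bialg_scheme \<Rightarrow> ('a \<Rightarrow> 'k) set"
  where "left_integrals K A =
    {f \<in> dual_space K A. \<forall>g \<in> dual_space K A.
      convolution K A g f = (\<lambda>x\<in>carrier A. g \<one>\<^bsub>A\<^esub> \<otimes>\<^bsub>K\<^esub> f x)}"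

end

theory Submission
  imports Defs
begin

text \<open>
  Test the integral \<open>\<Lambda>\<close> against the functionals \<open>g \<otimes> \<epsilon>\<^sub>B\<close> with \<open>g \<in> H\<^sup>*\<close>: by the counit axioms of
  \<open>B\<close> and of the coaction, \<open>((g \<otimes> \<epsilon>\<^sub>B) * \<Lambda>)(h \<otimes> b) = (g * \<Lambda>(- \<otimes> b))(h)\<close>, while
  \<open>(g \<otimes> \<epsilon>\<^sub>B)(1) = g(1)\<close>.
\<close>

section \<open>Linear maps\<close>

text \<open>The coproduct of \<open>h \<otimes> b\<close> splits \<open>b\<close> and multiplies the
  coaction of the second part of \<open>h\<close> into the first B-factor. A counit in that factor
  undoes both at once because it is multiplicative, so only the comultiplication of H survives. The
  obstacle is formal. \<open>tensor_lift\<close> sums over an arbitrary representative, and the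
  comultiplication of the bosonization nests four such sums. Evaluating the outermost one directly
  on a pure tensor would require bilinearity of a summand built from the other three. Instead a
  linear functional is moved inside first: it passes through each sum term by term, for any summand
  with values in the right space, because both sides use the same representative. The two innermost
  sums then collapse by counit axioms, and bilinearity has to be checked only for the scalar-valued
  sum over \<open>comult H h\<close> that remains.\<close>

lemma linear_mapI:
  assumes "\<And>x. x \<in> carrier M \<Longrightarrow> f x \<in> carrier N"
    and "\<And>x y. x \<in> carrier M \<Longrightarrow> y \<in> carrier M \<Longrightarrow> f (x \<oplus>\<^bsub>M\<^esub> y) = f x \<oplus>\<^bsub>N\<^esub> f y"
    and "\<And>c x. c \<in> carrier K \<Longrightarrow> x \<in> carrier M \<Longrightarrow> f (c \<odot>\<^bsub>M\<^esub> x) = c \<odot>\<^bsub>N\<^esub> f x"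
  shows "linear_map K M N f"
  using assms by (auto simp: linear_map_def)

lemma linear_mapD:
  assumes "linear_map K M N f"
  shows linear_map_closed: "x \<in> carrier M \<Longrightarrow> f x \<in> carrier N"
    and linear_map_add: "x \<in> carrier M \<Longrightarrow> y \<in> carrier M \<Longrightarrow> f (x \<oplus>\<^bsub>M\<^esub> y) = f x \<oplus>\<^bsub>N\<^esub> f y"
    and linear_map_smult: "c \<in> carrier K \<Longrightarrow> x \<in> carrier M \<Longrightarrow> f (c \<odot>\<^bsub>M\<^esub> x) = c \<odot>\<^bsub>N\<^esub> f x"
  using assms by (auto simp: linear_map_def)

lemma linear_map_comp:
  "linear_map K M N f \<Longrightarrow> linear_map K N P g \<Longrightarrow> linear_map K M P (\<lambda>x. g (f x))"
  by (auto simp: linear_map_def Pi_iff)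

text \<open>Members of \<open>dual_space\<close> are cut off outside the carrier; this transfers
  linearity to the cut-off function. The module axioms keep sums and multiples inside the carrier,
  where both functions agree.\<close>

lemma linear_map_cong:
  assumes "module K M" "linear_map K M N f" "\<And>x. x \<in> carrier M \<Longrightarrow> f x = g x"
  shows "linear_map K M N g"
proof -
  interpret module K M by fact
  show ?thesis
    using assms(2,3) by (auto simp: linear_map_def Pi_iff)
qed

lemma bilinear_mapI:
  assumes "\<And>x. x \<in> carrier M \<Longrightarrow> linear_map K N P (\<beta> x)"
    and "\<And>y. y \<in> carrier N \<Longrightarrow> linear_map K M P (\<lambda>x. \<beta> x y)"
  shows "bilinear_map K M N P \<beta>"
  using assms by (auto simp: bilinear_map_def)

lemma bilinear_mapD:
  assumes "bilinear_map K M N P \<beta>"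
  shows bilinear_map_right: "x \<in> carrier M \<Longrightarrow> linear_map K N P (\<beta> x)"
    and bilinear_map_left: "y \<in> carrier N \<Longrightarrow> linear_map K M P (\<lambda>x. \<beta> x y)"
    and bilinear_map_closed: "x \<in> carrier M \<Longrightarrow> y \<in> carrier N \<Longrightarrow> \<beta> x y \<in> carrier P"
  using assms by (auto simp: bilinear_map_def linear_map_def)

lemma linear_map_zero:
  assumes "module K M" "module K N" "linear_map K M N f"
  shows "f \<zero>\<^bsub>M\<^esub> = \<zero>\<^bsub>N\<^esub>"
proof -
  interpret M: module K M by fact
  interpret N: module K N by fact
  have "f (\<zero>\<^bsub>K\<^esub> \<odot>\<^bsub>M\<^esub> \<zero>\<^bsub>M\<^esub>) = \<zero>\<^bsub>K\<^esub> \<odot>\<^bsub>N\<^esub> f \<zero>\<^bsub>M\<^esub>"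
    by (rule linear_map_smult[OF assms(3)]) simp_all
  then show ?thesis
    using linear_map_closed[OF assms(3)] by simp
qed

lemma linear_map_neg:
  assumes "module K M" "module K N" "linear_map K M N f" "x \<in> carrier M"
  shows "f (\<ominus>\<^bsub>M\<^esub> x) = \<ominus>\<^bsub>N\<^esub> f x"
proof -
  interpret M: module K M by fact
  interpret N: module K N by fact
  have "f (\<ominus>\<^bsub>M\<^esub> x) \<oplus>\<^bsub>N\<^esub> f x = f (\<ominus>\<^bsub>M\<^esub> x \<oplus>\<^bsub>M\<^esub> x)"
    using assms(3,4) by (simp add: linear_map_add)
  also have "\<dots> = \<zero>\<^bsub>N\<^esub>"
    using assms by (simp add: M.l_neg linear_map_zero)
  finally show ?thesis
    using assms(3,4) by (simp add: linear_map_closed N.minus_equality)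
qed

lemma linear_map_minus:
  assumes "module K M" "module K N" "linear_map K M N f" "x \<in> carrier M" "y \<in> carrier M"
  shows "f (x \<ominus>\<^bsub>M\<^esub> y) = f x \<ominus>\<^bsub>N\<^esub> f y"
proof -
  interpret M: module K M by fact
  show ?thesis
    using assms by (simp add: a_minus_def linear_map_add linear_map_neg)
qed

lemma linear_map_finsum:
  assumes "module K M" "module K N" "linear_map K M N f" "finite A" "h \<in> A \<rightarrow> carrier M"
  shows "f (finsum M h A) = finsum N (\<lambda>i. f (h i)) A"
proof -
  interpret M: module K M by fact
  interpret N: module K N by fact
  note f = linear_mapD[OF assms(3)]
  show ?thesis
    using assms(4,5)
  proof (induction A rule: finite_induct)
    case empty
    then show ?case
      using linear_map_zero[OF assms(1-3)] by simp
  next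
    case (insert a A)
    then have "h \<in> A \<rightarrow> carrier M" "h a \<in> carrier M" "(\<lambda>i. f (h i)) \<in> A \<rightarrow> carrier N"
      by (auto simp: Pi_iff f)
    with insert show ?case
      by (simp add: f)
  qed
qed

text \<open>Meant for use with \<open>submodule_span_least\<close>: a linear map that kills the
  generators of a span kills the whole span.\<close>

lemma submodule_kernel:
  assumes "module K M" "module K N" "linear_map K M N f"
  shows "submodule {x \<in> carrier M. f x = \<zero>\<^bsub>N\<^esub>} K M"
proof -
  interpret M: module K M by fact
  interpret N: module K N by fact
  show ?thesis
    using linear_map_zero[OF assms] linear_map_neg[OF assms]
    by (intro M.submoduleI)
      (auto simp: linear_map_add[OF assms(3)] linear_map_smult[OF assms(3)])
qed

lemma module_base_module:
  assumes "cring K"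
  shows "module K (base_module K)"
proof -
  interpret cring K by fact
  show ?thesis
    by (rule moduleI[OF assms])
      (auto intro!: abelian_groupI a_assoc a_comm m_assoc l_distr r_distr l_neg
        bexI[of _ "\<ominus>\<^bsub>K\<^esub> x" for x] simp: base_module_def)
qed

lemma base_module_simps [simp]:
  "carrier (base_module K) = carrier K"
  "add (base_module K) = add K"
  "smult (base_module K) = mult K"
  by (simp_all add: base_module_def)

lemma linear_map_scale:
  assumes "cring K" "linear_map K M (base_module K) f" "c \<in> carrier K"
  shows "linear_map K M (base_module K) (\<lambda>x. c \<otimes>\<^bsub>K\<^esub> f x)"
proof -
  interpret cring K by fact
  show ?thesis
    using assms(3) linear_mapD[OF assms(2)]
    by (intro linear_mapI) (auto simp: r_distr m_lcomm)
qed

text \<open>Source of the functionals that are tested on tensor products: \<open>g\<close> with the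
  counit of B, \<open>G\<close> with \<Lambda>, and \<open>g\<close> with \<Lambda> at a fixed
  B-factor.\<close>

lemma bilinear_map_product:
  assumes "cring K" "linear_map K M (base_module K) f" "linear_map K N (base_module K) g"
  shows "bilinear_map K M N (base_module K) (\<lambda>x y. f x \<otimes>\<^bsub>K\<^esub> g y)"
proof (rule bilinear_mapI)
  interpret cring K by fact
  note f = linear_mapD[OF assms(2)] and g = linear_mapD[OF assms(3)]
  show "linear_map K N (base_module K) (\<lambda>y. f x \<otimes>\<^bsub>K\<^esub> g y)" if "x \<in> carrier M" for x
    using that f by (intro linear_map_scale[OF assms(1,3)]) simp
  show "linear_map K M (base_module K) (\<lambda>x. f x \<otimes>\<^bsub>K\<^esub> g y)" if "y \<in> carrier N" for y
    using that f g by (intro linear_mapI) (auto simp: l_distr m_assoc)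
qed


section \<open>Free modules, spans and quotients\<close>

lemma free_module_simps [simp]:
  "zero (free_module K X) = (\<lambda>_. \<zero>\<^bsub>K\<^esub>)"
  "add (free_module K X) = (\<lambda>f g x. f x \<oplus>\<^bsub>K\<^esub> g x)"
  "smult (free_module K X) = (\<lambda>c f x. c \<otimes>\<^bsub>K\<^esub> f x)"
  by (simp_all add: free_module_def)

lemma free_module_carrier:
  "f \<in> carrier (free_module K X) \<longleftrightarrow>
    (\<forall>x. f x \<in> carrier K) \<and> (\<forall>x. x \<notin> X \<longrightarrow> f x = \<zero>\<^bsub>K\<^esub>) \<and> finite {x. f x \<noteq> \<zero>\<^bsub>K\<^esub>}"
  by (simp add: free_module_def)

lemma free_moduleD:
  assumes "f \<in> carrier (free_module K X)"
  shows free_module_value: "f x \<in> carrier K"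
    and free_module_support: "f x \<noteq> \<zero>\<^bsub>K\<^esub> \<Longrightarrow> x \<in> X"
    and free_module_finite: "finite {x. f x \<noteq> \<zero>\<^bsub>K\<^esub>}"
  using assms unfolding free_module_carrier by blast+

lemma module_free_module:
  assumes "cring K"
  shows "module K (free_module K X)"
proof -
  interpret cring K by fact
  let ?F = "free_module K X"
  have add: "(\<lambda>x. f x \<oplus>\<^bsub>K\<^esub> g x) \<in> carrier ?F" if "f \<in> carrier ?F" "g \<in> carrier ?F" for f g
  proof -
    have "{x. f x \<oplus>\<^bsub>K\<^esub> g x \<noteq> \<zero>\<^bsub>K\<^esub>} \<subseteq> {x. f x \<noteq> \<zero>\<^bsub>K\<^esub>} \<union> {x. g x \<noteq> \<zero>\<^bsub>K\<^esub>}" by auto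
    with that show ?thesis
      by (auto simp: free_module_carrier intro: finite_subset)
  qed
  have smult: "(\<lambda>x. c \<otimes>\<^bsub>K\<^esub> f x) \<in> carrier ?F" if "c \<in> carrier K" "f \<in> carrier ?F" for c f
  proof -
    have "{x. c \<otimes>\<^bsub>K\<^esub> f x \<noteq> \<zero>\<^bsub>K\<^esub>} \<subseteq> {x. f x \<noteq> \<zero>\<^bsub>K\<^esub>}"
      using that by auto
    with that show ?thesis
      by (auto simp: free_module_carrier intro: finite_subset)
  qed
  have neg: "(\<lambda>x. \<ominus>\<^bsub>K\<^esub> f x) \<in> carrier ?F" if "f \<in> carrier ?F" for f
  proof -
    have "{x. \<ominus>\<^bsub>K\<^esub> f x \<noteq> \<zero>\<^bsub>K\<^esub>} \<subseteq> {x. f x \<noteq> \<zero>\<^bsub>K\<^esub>}" by auto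
    with that show ?thesis
      by (auto simp: free_module_carrier intro: finite_subset)
  qed
  have val: "f x \<in> carrier K" if "f \<in> carrier ?F" for f x
    using that by (rule free_module_value)
  have "abelian_group ?F"
  proof (rule abelian_groupI)
    show "\<exists>g\<in>carrier ?F. g \<oplus>\<^bsub>?F\<^esub> f = \<zero>\<^bsub>?F\<^esub>" if "f \<in> carrier ?F" for f
      by (rule bexI[OF _ neg[OF that]]) (simp add: fun_eq_iff l_neg val[OF that])
  qed (auto simp: add fun_eq_iff val a_ac, simp add: free_module_carrier)
  then show ?thesis
    by (intro moduleI[OF assms])
      (auto simp: smult fun_eq_iff val l_distr r_distr m_assoc)
qed

lemma free_basis_closed:
  assumes "cring K" "x \<in> X"
  shows "free_basis K x \<in> carrier (free_module K X)"
proof -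
  interpret cring K by fact
  have "{y. free_basis K x y \<noteq> \<zero>\<^bsub>K\<^esub>} \<subseteq> {x}"
    by (auto simp: free_basis_def)
  with assms(2) show ?thesis
    by (auto simp: free_module_carrier intro: finite_subset) (auto simp: free_basis_def)
qed

lemma submodule_submodule_span:
  assumes "module K M" "A \<subseteq> carrier M"
  shows "submodule (submodule_span K M A) K M"
proof -
  interpret M: module K M by fact
  note E = M.submoduleE and Z = subgroup.one_closed[OF submodule.axioms(1), simplified]
  \<comment> \<open>The intersected family has to be nonempty: an empty intersection would be the
    whole type and not a subset of the carrier.\<close>
  have "carrier M \<in> {S. submodule S K M \<and> A \<subseteq> S}"
    using M.carrier_is_submodule assms(2) by simp
  then have "submodule_span K M A \<subseteq> carrier M"
    unfolding submodule_span_def by blast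
  then show ?thesis
    by (rule M.submoduleI) (auto simp: submodule_span_def E Z)
qed

lemma submodule_span_least:
  "submodule S K M \<Longrightarrow> A \<subseteq> S \<Longrightarrow> submodule_span K M A \<subseteq> S"
  by (auto simp: submodule_span_def)

lemma submodule_span_superset: "A \<subseteq> submodule_span K M A"
  by (auto simp: submodule_span_def)

lemma abelian_subgroup_submodule:
  assumes "module K M" "submodule S K M"
  shows "abelian_subgroup S M"
proof -
  interpret M: module K M by fact
  show ?thesis
    by (intro abelian_subgroupI2 M.a_comm_group submodule.axioms(1)[OF assms(2)])
qed

lemma quotient_module_carrier:
  "carrier (quotient_module K M S) = (\<lambda>x. S +>\<^bsub>M\<^esub> x) ` carrier M"
  by (auto simp: quotient_module_def A_RCOSETS_def')

lemma quotient_module_add: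
  assumes "module K M" "submodule S K M" "x \<in> carrier M" "y \<in> carrier M"
  shows "(S +>\<^bsub>M\<^esub> x) \<oplus>\<^bsub>quotient_module K M S\<^esub> (S +>\<^bsub>M\<^esub> y) = S +>\<^bsub>M\<^esub> (x \<oplus>\<^bsub>M\<^esub> y)"
  using abelian_subgroup.a_rcos_sum[OF abelian_subgroup_submodule[OF assms(1,2)] assms(3,4)]
  by (simp add: quotient_module_def)

text \<open>The union in \<open>quotient_module\<close> runs over all representatives of a coset.
  Since \<open>S\<close> is closed under scalars, they all yield the same coset, and since a coset
  is nonempty, the union is that coset.\<close>

lemma quotient_module_smult:
  assumes "module K M" "submodule S K M" "c \<in> carrier K" "x \<in> carrier M"
  shows "c \<odot>\<^bsub>quotient_module K M S\<^esub> (S +>\<^bsub>M\<^esub> x) = S +>\<^bsub>M\<^esub> (c \<odot>\<^bsub>M\<^esub> x)"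
proof -
  interpret M: module K M by fact
  interpret S: abelian_subgroup S M
    by (rule abelian_subgroup_submodule[OF assms(1,2)])
  have "S +>\<^bsub>M\<^esub> (c \<odot>\<^bsub>M\<^esub> y) = S +>\<^bsub>M\<^esub> (c \<odot>\<^bsub>M\<^esub> x)" if y: "y \<in> S +>\<^bsub>M\<^esub> x" for y
  proof -
    obtain s where s: "s \<in> S" "y = s \<oplus>\<^bsub>M\<^esub> x"
      using y by (auto simp: a_r_coset_def')
    then have "s \<in> carrier M" using S.a_subset by auto
    with s assms have "c \<odot>\<^bsub>M\<^esub> y = c \<odot>\<^bsub>M\<^esub> s \<oplus>\<^bsub>M\<^esub> c \<odot>\<^bsub>M\<^esub> x"
      by (simp add: M.smult_r_distr)
    then have "c \<odot>\<^bsub>M\<^esub> y \<in> S +>\<^bsub>M\<^esub> (c \<odot>\<^bsub>M\<^esub> x)"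
      using M.a_rcosI[OF submodule.smult_closed[OF assms(2,3) s(1)] S.a_subset] assms(3,4) by simp
    then show ?thesis
      using M.a_repr_independence[OF _ _ S.a_subgroup] assms by simp
  qed
  moreover have "S +>\<^bsub>M\<^esub> x \<noteq> {}"
    using S.a_rcos_self[OF assms(4)] by blast
  ultimately have "(\<Union>y\<in>S +>\<^bsub>M\<^esub> x. S +>\<^bsub>M\<^esub> (c \<odot>\<^bsub>M\<^esub> y)) = S +>\<^bsub>M\<^esub> (c \<odot>\<^bsub>M\<^esub> x)"
    by (intro SUP_eq_const)
  then show ?thesis
    by (simp add: quotient_module_def)
qed

lemma module_quotient_module:
  assumes "module K M" "submodule S K M"
  shows "module K (quotient_module K M S)"
proof -
  interpret M: module K M by fact
  interpret S: abelian_subgroup S M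
    by (rule abelian_subgroup_submodule[OF assms])
  let ?Q = "quotient_module K M S"
  \<comment> \<open>The zero of the quotient is \<open>S\<close> itself; written as a coset it
    becomes accessible to the coset rules for sums.\<close>
  have S: "S +>\<^bsub>M\<^esub> \<zero>\<^bsub>M\<^esub> = \<zero>\<^bsub>?Q\<^esub>"
    using S.a_subset by (simp add: quotient_module_def)
  have "abelian_group ?Q"
  proof (rule abelian_groupI)
    show "\<zero>\<^bsub>?Q\<^esub> \<in> carrier ?Q"
      by (auto simp: quotient_module_carrier S[symmetric])
    show "\<exists>Y\<in>carrier ?Q. Y \<oplus>\<^bsub>?Q\<^esub> X = \<zero>\<^bsub>?Q\<^esub>" if "X \<in> carrier ?Q" for X
    proof -
      obtain x where x: "x \<in> carrier M" "X = S +>\<^bsub>M\<^esub> x"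
        using \<open>X \<in> carrier ?Q\<close> by (auto simp: quotient_module_carrier)
      then show ?thesis
        by (intro bexI[of _ "S +>\<^bsub>M\<^esub> (\<ominus>\<^bsub>M\<^esub> x)"])
          (auto simp: quotient_module_carrier quotient_module_add[OF assms] M.l_neg S)
    qed
  qed (auto simp: quotient_module_carrier quotient_module_add[OF assms] M.a_ac S[symmetric])
  then show ?thesis
    by (intro moduleI M.R.is_cring)
      (auto simp: quotient_module_carrier quotient_module_add[OF assms] quotient_module_smult[OF assms]
        M.smult_l_distr M.smult_r_distr M.smult_assoc1)
qed


section \<open>Tensor products\<close>

text \<open>This is \<open>tensor_lift\<close> without the choice of a representative. The
  separation pays off because the sum is linear in \<open>x\<close> for every \<beta> with values in
  \<open>P\<close>; bilinearity enters only to make the choice harmless.\<close>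

definition free_lift ::
    "('k, 'z) ring_scheme \<Rightarrow> ('k, 'l, 'r) module_scheme \<Rightarrow> ('m \<Rightarrow> 'n \<Rightarrow> 'l) \<Rightarrow> ('m \<times> 'n \<Rightarrow> 'k) \<Rightarrow> 'l"
  where "free_lift K P \<beta> x = (\<Oplus>\<^bsub>P\<^esub>p \<in> {p. x p \<noteq> \<zero>\<^bsub>K\<^esub>}. x p \<odot>\<^bsub>P\<^esub> \<beta> (fst p) (snd p))"

lemma tensor_lift_eq_free_lift: "tensor_lift K P \<beta> t = free_lift K P \<beta> (SOME x. x \<in> t)"
  by (simp add: tensor_lift_def free_lift_def Let_def)

text \<open>The supports of \<open>x\<close>, \<open>y\<close> and their sum may differ, by
  cancellation for instance. Padding with zero terms to a common finite index set lets such sums be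
  compared term by term.\<close>

lemma free_lift_superset:
  assumes "module K P" "\<And>m n. m \<in> U \<Longrightarrow> n \<in> V \<Longrightarrow> \<beta> m n \<in> carrier P"
    and "x \<in> carrier (free_module K (U \<times> V))"
    and "finite A" "{p. x p \<noteq> \<zero>\<^bsub>K\<^esub>} \<subseteq> A" "A \<subseteq> U \<times> V"
  shows "free_lift K P \<beta> x = (\<Oplus>\<^bsub>P\<^esub>p \<in> A. x p \<odot>\<^bsub>P\<^esub> \<beta> (fst p) (snd p))"
proof -
  interpret P: module K P by fact
  show ?thesis
    unfolding free_lift_def
  proof (rule P.add.finprod_mono_neutral_cong_left)
    show "(\<lambda>p. x p \<odot>\<^bsub>P\<^esub> \<beta> (fst p) (snd p)) \<in> A \<rightarrow> carrier P"
      using assms(2,3,6) by (auto simp: free_module_carrier)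
    show "x p \<odot>\<^bsub>P\<^esub> \<beta> (fst p) (snd p) = \<zero>\<^bsub>P\<^esub>" if "p \<in> A - {p. x p \<noteq> \<zero>\<^bsub>K\<^esub>}" for p
      using that assms(2,6) by (cases p) (auto intro: P.smult_l_null)
  qed (use assms in auto)
qed

lemma linear_map_free_lift:
  assumes "module K P" "\<And>m n. m \<in> U \<Longrightarrow> n \<in> V \<Longrightarrow> \<beta> m n \<in> carrier P"
  shows "linear_map K (free_module K (U \<times> V)) P (free_lift K P \<beta>)"
proof (rule linear_mapI)
  interpret P: module K P by fact
  let ?F = "free_module K (U \<times> V)"
  interpret F: module K ?F by (rule module_free_module[OF P.R.is_cring])
  let ?s = "\<lambda>x. {p. x p \<noteq> \<zero>\<^bsub>K\<^esub>}"
  have superset: "free_lift K P \<beta> x = (\<Oplus>\<^bsub>P\<^esub>p \<in> A. x p \<odot>\<^bsub>P\<^esub> \<beta> (fst p) (snd p))"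
    if "x \<in> carrier ?F" "finite A" "?s x \<subseteq> A" "A \<subseteq> U \<times> V" for x A
    using assms(2) that by (intro free_lift_superset[OF assms(1)]) simp_all
  have fin: "finite (?s x)" and sub: "?s x \<subseteq> U \<times> V" if "x \<in> carrier ?F" for x
    using that by (auto dest: free_module_finite free_module_support)
  have val: "x p \<in> carrier K" if "x \<in> carrier ?F" for x p
    using that by (rule free_module_value)
  have summand: "x p \<odot>\<^bsub>P\<^esub> \<beta> (fst p) (snd p) \<in> carrier P" if "x \<in> carrier ?F" "p \<in> U \<times> V" for x p
    using that by (auto simp: val assms(2))
  have \<beta>: "\<beta> (fst p) (snd p) \<in> carrier P" if "p \<in> U \<times> V" for p
    using that by (auto simp: assms(2))
  show "free_lift K P \<beta> x \<in> carrier P" if "x \<in> carrier ?F" for x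
    unfolding free_lift_def using sub[OF that] by (auto intro!: P.finsum_closed summand[OF that])
  show "free_lift K P \<beta> (x \<oplus>\<^bsub>?F\<^esub> y) = free_lift K P \<beta> x \<oplus>\<^bsub>P\<^esub> free_lift K P \<beta> y"
    if xy: "x \<in> carrier ?F" "y \<in> carrier ?F" for x y
  proof -
    let ?A = "?s x \<union> ?s y"
    have A: "finite ?A" "?A \<subseteq> U \<times> V"
      using fin sub xy by auto
    have "x \<oplus>\<^bsub>?F\<^esub> y \<in> carrier ?F" "?s (x \<oplus>\<^bsub>?F\<^esub> y) \<subseteq> ?A"
      using xy by blast (use xy in auto)
    then have "free_lift K P \<beta> (x \<oplus>\<^bsub>?F\<^esub> y) =
        (\<Oplus>\<^bsub>P\<^esub>p \<in> ?A. (x \<oplus>\<^bsub>?F\<^esub> y) p \<odot>\<^bsub>P\<^esub> \<beta> (fst p) (snd p))"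
      using A by (intro superset)
    also have "\<dots> = (\<Oplus>\<^bsub>P\<^esub>p \<in> ?A. x p \<odot>\<^bsub>P\<^esub> \<beta> (fst p) (snd p) \<oplus>\<^bsub>P\<^esub> y p \<odot>\<^bsub>P\<^esub> \<beta> (fst p) (snd p))"
      using subsetD[OF A(2), THEN \<beta>]
      by (intro P.finsum_cong' refl Pi_I) (simp_all add: P.smult_l_distr val[OF xy(1)] val[OF xy(2)])
    also have "\<dots> = (\<Oplus>\<^bsub>P\<^esub>p \<in> ?A. x p \<odot>\<^bsub>P\<^esub> \<beta> (fst p) (snd p)) \<oplus>\<^bsub>P\<^esub>
        (\<Oplus>\<^bsub>P\<^esub>p \<in> ?A. y p \<odot>\<^bsub>P\<^esub> \<beta> (fst p) (snd p))"
      using A(2) summand[OF xy(1)] summand[OF xy(2)] by (intro P.finsum_addf Pi_I) blast+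
    also have "\<dots> = free_lift K P \<beta> x \<oplus>\<^bsub>P\<^esub> free_lift K P \<beta> y"
      using superset[OF xy(1) A(1) _ A(2)] superset[OF xy(2) A(1) _ A(2)] by simp
    finally show ?thesis .
  qed
  show "free_lift K P \<beta> (c \<odot>\<^bsub>?F\<^esub> x) = c \<odot>\<^bsub>P\<^esub> free_lift K P \<beta> x"
    if cx: "c \<in> carrier K" "x \<in> carrier ?F" for c x
  proof -
    have "c \<odot>\<^bsub>?F\<^esub> x \<in> carrier ?F" "?s (c \<odot>\<^bsub>?F\<^esub> x) \<subseteq> ?s x"
      using cx by blast (use cx in auto)
    then have "free_lift K P \<beta> (c \<odot>\<^bsub>?F\<^esub> x) =
        (\<Oplus>\<^bsub>P\<^esub>p \<in> ?s x. (c \<odot>\<^bsub>?F\<^esub> x) p \<odot>\<^bsub>P\<^esub> \<beta> (fst p) (snd p))"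
      using fin[OF cx(2)] sub[OF cx(2)] by (intro superset)
    also have "\<dots> = (\<Oplus>\<^bsub>P\<^esub>p \<in> ?s x. c \<odot>\<^bsub>P\<^esub> (x p \<odot>\<^bsub>P\<^esub> \<beta> (fst p) (snd p)))"
      using subsetD[OF sub[OF cx(2)], THEN \<beta>]
      by (intro P.finsum_cong' refl Pi_I) (simp_all add: P.smult_assoc1 val[OF cx(2)] cx(1))
    also have "\<dots> = c \<odot>\<^bsub>P\<^esub> free_lift K P \<beta> x"
      unfolding free_lift_def using sub[OF cx(2)]
      by (intro P.finsum_smult_ldistr[symmetric] fin cx Pi_I summand) auto
    finally show ?thesis .
  qed
qed

lemma free_lift_basis:
  assumes "module K P" "\<And>m n. m \<in> U \<Longrightarrow> n \<in> V \<Longrightarrow> \<beta> m n \<in> carrier P" "m \<in> U" "n \<in> V"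
  shows "free_lift K P \<beta> (free_basis K (m, n)) = \<beta> m n"
proof -
  interpret P: module K P by fact
  have "free_lift K P \<beta> (free_basis K (m, n)) =
      (\<Oplus>\<^bsub>P\<^esub>p \<in> {(m, n)}. free_basis K (m, n) p \<odot>\<^bsub>P\<^esub> \<beta> (fst p) (snd p))"
    by (rule free_lift_superset[OF assms(1,2)])
      (use assms(3,4) in \<open>auto intro!: free_basis_closed P.R.is_cring, auto simp: free_basis_def split: if_splits\<close>)
  also have "\<dots> = \<beta> m n"
    using assms(2-4) by (simp add: free_basis_def)
  finally show ?thesis .
qed

section \<open>Tensor relations and bilinearity of pure tensors\<close>

lemma tensor_relations_subset:
  assumes "module K M" "module K N"
  shows "tensor_relations K M N \<subseteq> carrier (free_module K (carrier M \<times> carrier N))"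
proof -
  interpret M: module K M by fact
  interpret N: module K N by fact
  interpret F: module K "free_module K (carrier M \<times> carrier N)"
    by (rule module_free_module[OF M.R.is_cring])
  \<comment> \<open>Unfolded pointwise, the operations of the free module would no longer match the
    module laws provided by \<open>F\<close>.\<close>
  note [simp del] = free_module_simps
  have [simp]: "free_basis K (m, n) \<in> carrier (free_module K (carrier M \<times> carrier N))"
    if "m \<in> carrier M" "n \<in> carrier N" for m n
    using that by (auto intro: free_basis_closed M.R.is_cring)
  show ?thesis
    by (auto simp: tensor_relations_def Let_def)
qed

lemma submodule_tensor_kernel:
  assumes "module K M" "module K N"
  shows "submodule (tensor_kernel K M N) K (free_module K (carrier M \<times> carrier N))"
proof -
  interpret M: module K M by fact
  show ?thesis
    unfolding tensor_kernel_def
    by (rule submodule_submodule_span[OF module_free_module[OF M.R.is_cring] tensor_relations_subset[OF assms]])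
qed

lemma module_tensor:
  assumes "module K M" "module K N"
  shows "module K (tensor K M N)"
proof -
  interpret M: module K M by fact
  show ?thesis
    unfolding tensor_def
    by (rule module_quotient_module[OF module_free_module[OF M.R.is_cring] submodule_tensor_kernel[OF assms]])
qed

lemma tens_closed:
  assumes "module K M" "m \<in> carrier M" "n \<in> carrier N"
  shows "tens K M N m n \<in> carrier (tensor K M N)"
proof -
  interpret M: module K M by fact
  show ?thesis
    using assms(2,3) M.R.is_cring
    by (auto simp: tensor_def tens_def quotient_module_carrier intro!: imageI free_basis_closed)
qed

text \<open>The four families in \<open>tensor_relations\<close> are the four laws of bilinearity:
  elements of the free module whose difference is a generator of the kernel have the same
  coset.\<close>

lemma bilinear_map_tens:
  assumes "module K M" "module K N"
  shows "bilinear_map K M N (tensor K M N) (tens K M N)"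
proof -
  interpret M: module K M by fact
  interpret N: module K N by fact
  let ?F = "free_module K (carrier M \<times> carrier N)" and ?S = "tensor_kernel K M N"
  note F = module_free_module[OF M.R.is_cring] and S = submodule_tensor_kernel[OF assms]
  interpret F: module K ?F by (rule F)
  interpret S: abelian_subgroup ?S ?F by (rule abelian_subgroup_submodule[OF F S])
  note [simp del] = free_module_simps
  have basis [simp]: "free_basis K (m, n) \<in> carrier ?F" if "m \<in> carrier M" "n \<in> carrier N" for m n
    using that by (auto intro: free_basis_closed M.R.is_cring)
  have eq: "?S +>\<^bsub>?F\<^esub> x = ?S +>\<^bsub>?F\<^esub> y"
    if "x \<ominus>\<^bsub>?F\<^esub> y \<in> tensor_relations K M N" "x \<in> carrier ?F" "y \<in> carrier ?F" for x y
  proof -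
    have "x \<ominus>\<^bsub>?F\<^esub> y \<in> ?S"
      unfolding tensor_kernel_def using that(1) by (rule subsetD[OF submodule_span_superset])
    then have "(x \<ominus>\<^bsub>?F\<^esub> y) \<oplus>\<^bsub>?F\<^esub> y \<in> ?S +>\<^bsub>?F\<^esub> y"
      by (auto simp: a_r_coset_def')
    moreover have "(x \<ominus>\<^bsub>?F\<^esub> y) \<oplus>\<^bsub>?F\<^esub> y = x"
      using that by (simp add: a_minus_def F.a_assoc F.l_neg)
    ultimately show ?thesis
      using F.a_repr_independence[OF _ that(3) S.a_subgroup] by simp
  qed
  let ?e = "\<lambda>m n. free_basis K (m, n)"
  have rel1: "?e (m \<oplus>\<^bsub>M\<^esub> m') n \<ominus>\<^bsub>?F\<^esub> (?e m n \<oplus>\<^bsub>?F\<^esub> ?e m' n) \<in> tensor_relations K M N"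
    if "m \<in> carrier M" "m' \<in> carrier M" "n \<in> carrier N" for m m' n
    using that unfolding tensor_relations_def Let_def by blast
  have rel2: "?e m (n \<oplus>\<^bsub>N\<^esub> n') \<ominus>\<^bsub>?F\<^esub> (?e m n \<oplus>\<^bsub>?F\<^esub> ?e m n') \<in> tensor_relations K M N"
    if "m \<in> carrier M" "n \<in> carrier N" "n' \<in> carrier N" for m n n'
    using that unfolding tensor_relations_def Let_def by blast
  have rel3: "?e (c \<odot>\<^bsub>M\<^esub> m) n \<ominus>\<^bsub>?F\<^esub> (c \<odot>\<^bsub>?F\<^esub> ?e m n) \<in> tensor_relations K M N"
    if "c \<in> carrier K" "m \<in> carrier M" "n \<in> carrier N" for c m n
    using that unfolding tensor_relations_def Let_def by blast
  have rel4: "?e m (c \<odot>\<^bsub>N\<^esub> n) \<ominus>\<^bsub>?F\<^esub> (c \<odot>\<^bsub>?F\<^esub> ?e m n) \<in> tensor_relations K M N"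
    if "c \<in> carrier K" "m \<in> carrier M" "n \<in> carrier N" for c m n
    using that unfolding tensor_relations_def Let_def by blast
  have closed: "?S +>\<^bsub>?F\<^esub> ?e m n \<in> carrier (quotient_module K ?F ?S)"
    if "m \<in> carrier M" "n \<in> carrier N" for m n
    using that by (simp add: quotient_module_carrier)
  show ?thesis
    unfolding tensor_def tens_def
    by (intro bilinear_mapI linear_mapI)
      (simp_all add: closed quotient_module_add[OF F S] quotient_module_smult[OF F S] eq[OF rel1] eq[OF rel2]
        eq[OF rel3] eq[OF rel4])
qed

text \<open>Bilinearity of \<beta> makes \<open>free_lift\<close> vanish on each relation. Its
  kernel is a submodule and so contains everything the relations span.\<close>

lemma tensor_kernel_free_lift:
  assumes "module K M" "module K N" "module K P" "bilinear_map K M N P \<beta>" "x \<in> tensor_kernel K M N"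
  shows "free_lift K P \<beta> x = \<zero>\<^bsub>P\<^esub>"
proof -
  interpret M: module K M by fact
  interpret N: module K N by fact
  interpret P: module K P by fact
  let ?F = "free_module K (carrier M \<times> carrier N)"
  note F = module_free_module[OF M.R.is_cring]
  interpret F: module K ?F by (rule F)
  note [simp del] = free_module_simps
  have closed: "\<beta> m n \<in> carrier P" if "m \<in> carrier M" "n \<in> carrier N" for m n
    using that by (rule bilinear_map_closed[OF assms(4)])
  note lin = linear_map_free_lift[OF assms(3), of "carrier M" "carrier N" \<beta>, OF closed]
  have [simp]: "free_basis K (m, n) \<in> carrier ?F" if "m \<in> carrier M" "n \<in> carrier N" for m n
    using that by (auto intro: free_basis_closed M.R.is_cring)
  note [simp] = free_lift_basis[OF assms(3) closed] linear_map_minus[OF F assms(3) lin]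
    linear_map_add[OF lin] linear_map_smult[OF lin] closed
    linear_map_add[OF bilinear_map_left[OF assms(4)]] linear_map_add[OF bilinear_map_right[OF assms(4)]]
    linear_map_smult[OF bilinear_map_left[OF assms(4)]] linear_map_smult[OF bilinear_map_right[OF assms(4)]]
  have "tensor_relations K M N \<subseteq> {x \<in> carrier ?F. free_lift K P \<beta> x = \<zero>\<^bsub>P\<^esub>}"
    by (auto simp: tensor_relations_def Let_def a_minus_def[of P] P.r_neg)
  from submodule_span_least[OF submodule_kernel[OF F assms(3) lin] this] assms(5)
  show ?thesis
    unfolding tensor_kernel_def by blast
qed

text \<open>Justifies the \<open>SOME\<close> in \<open>tensor_lift\<close>: elements of the tensor
  product are cosets, hence nonempty subsets of the free module.\<close>

lemma tensor_representative:
  assumes "module K M" "module K N" "t \<in> carrier (tensor K M N)"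
  shows "(SOME x. x \<in> t) \<in> carrier (free_module K (carrier M \<times> carrier N))"
    and "(SOME x. x \<in> t) \<in> t"
proof -
  interpret M: module K M by fact
  let ?F = "free_module K (carrier M \<times> carrier N)"
  note F = module_free_module[OF M.R.is_cring]
  interpret F: module K ?F by (rule F)
  interpret S: abelian_subgroup "tensor_kernel K M N" ?F
    by (rule abelian_subgroup_submodule[OF F submodule_tensor_kernel[OF assms(1,2)]])
  obtain x where x: "x \<in> carrier ?F" "t = tensor_kernel K M N +>\<^bsub>?F\<^esub> x"
    using assms(3) by (auto simp: tensor_def quotient_module_carrier)
  then have "x \<in> t"
    using S.a_rcos_self by simp
  then show *: "(SOME x. x \<in> t) \<in> t"
    by (rule someI[where P = "\<lambda>x. x \<in> t"])
  show "(SOME x. x \<in> t) \<in> carrier ?F"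
    using * x F.a_r_coset_subset_G[OF S.a_subset] by blast
qed

text \<open>Well-definedness: the chosen representative differs from \<open>x\<close> by an element
  of the kernel, on which \<open>free_lift\<close> vanishes.\<close>

lemma tensor_lift_coset:
  assumes "module K M" "module K N" "module K P" "bilinear_map K M N P \<beta>"
    and "x \<in> carrier (free_module K (carrier M \<times> carrier N))"
  shows "tensor_lift K P \<beta> (tensor_kernel K M N +>\<^bsub>free_module K (carrier M \<times> carrier N)\<^esub> x) = free_lift K P \<beta> x"
proof -
  interpret M: module K M by fact
  interpret P: module K P by fact
  let ?F = "free_module K (carrier M \<times> carrier N)"
  note lin = linear_map_free_lift[OF assms(3), of "carrier M" "carrier N" \<beta>,
      OF bilinear_map_closed[OF assms(4)]]
  let ?t = "tensor_kernel K M N +>\<^bsub>?F\<^esub> x"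
  have "?t \<in> carrier (tensor K M N)"
    using assms(5) by (auto simp: tensor_def quotient_module_carrier)
  from tensor_representative(2)[OF assms(1,2) this]
  obtain s where s: "s \<in> tensor_kernel K M N" "(SOME x. x \<in> ?t) = s \<oplus>\<^bsub>?F\<^esub> x"
    by (auto simp: a_r_coset_def')
  have "s \<in> carrier ?F"
    using s(1) subgroup.subset[OF submodule.axioms(1)[OF submodule_tensor_kernel[OF assms(1,2)]]]
    by auto
  then show ?thesis
    unfolding tensor_lift_eq_free_lift s(2)
    using tensor_kernel_free_lift[OF assms(1-4) s(1)] assms(5) linear_map_closed[OF lin]
    by (simp add: linear_map_add[OF lin] del: free_module_simps)
qed

section \<open>Universal property of the tensor product\<close>

lemma tensor_lift_tens:
  assumes "module K M" "module K N" "module K P" "bilinear_map K M N P \<beta>"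
    and "m \<in> carrier M" "n \<in> carrier N"
  shows "tensor_lift K P \<beta> (tens K M N m n) = \<beta> m n"
proof -
  interpret M: module K M by fact
  show ?thesis
    unfolding tens_def using assms(5,6)
    by (simp add: tensor_lift_coset[OF assms(1-4)] free_basis_closed M.R.is_cring
        free_lift_basis[OF assms(3) bilinear_map_closed[OF assms(4)]])
qed

lemma linear_map_tensor_lift:
  assumes "module K M" "module K N" "module K P" "bilinear_map K M N P \<beta>"
  shows "linear_map K (tensor K M N) P (tensor_lift K P \<beta>)"
proof -
  interpret M: module K M by fact
  let ?F = "free_module K (carrier M \<times> carrier N)"
  note F = module_free_module[OF M.R.is_cring] and S = submodule_tensor_kernel[OF assms(1,2)]
  interpret F: module K ?F by (rule F)
  note lin = linear_map_free_lift[OF assms(3), of "carrier M" "carrier N" \<beta>,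
      OF bilinear_map_closed[OF assms(4)]]
  note [simp del] = free_module_simps
  show ?thesis
    unfolding tensor_def
    by (rule linear_mapI)
      (auto simp: quotient_module_carrier quotient_module_add[OF F S] quotient_module_smult[OF F S]
        tensor_lift_coset[OF assms] linear_mapD[OF lin])
qed

section \<open>Sweedler sums over a fixed tensor\<close>

lemma tensor_lift_cong:
  assumes "module K M" "module K N" "module K P" "t \<in> carrier (tensor K M N)"
    and "\<And>m n. m \<in> carrier M \<Longrightarrow> n \<in> carrier N \<Longrightarrow> \<beta> m n = \<gamma> m n"
    and "\<And>m n. m \<in> carrier M \<Longrightarrow> n \<in> carrier N \<Longrightarrow> \<gamma> m n \<in> carrier P"
  shows "tensor_lift K P \<beta> t = tensor_lift K P \<gamma> t"
proof -
  interpret P: module K P by fact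
  let ?x = "SOME x. x \<in> t"
  note x = free_moduleD[OF tensor_representative(1)[OF assms(1,2,4)]]
  have "\<beta> (fst p) (snd p) = \<gamma> (fst p) (snd p)" "\<gamma> (fst p) (snd p) \<in> carrier P"
    if "?x p \<noteq> \<zero>\<^bsub>K\<^esub>" for p
    using x(2)[OF that] assms(5,6) by (auto simp: mem_Times_iff)
  with x(1) show ?thesis
    unfolding tensor_lift_eq_free_lift free_lift_def
    by (intro P.finsum_cong') auto
qed

lemma tensor_lift_closed:
  assumes "module K M" "module K N" "module K P" "t \<in> carrier (tensor K M N)"
    and "\<And>m n. m \<in> carrier M \<Longrightarrow> n \<in> carrier N \<Longrightarrow> \<beta> m n \<in> carrier P"
  shows "tensor_lift K P \<beta> t \<in> carrier P"
  unfolding tensor_lift_eq_free_lift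
  by (rule linear_map_closed[OF linear_map_free_lift[OF assms(3,5)] tensor_representative(1)[OF assms(1,2,4)]])

text \<open>Both sides sum over the same chosen representative of \<open>t\<close>, so \<phi> passes
  through a finite sum term by term. This is what allows nested Sweedler sums to be handled before
  anything is known about bilinearity of the summand.\<close>

lemma linear_map_of_tensor_lift:
  assumes "module K M" "module K N" "module K P" "module K Q" "linear_map K P Q \<phi>"
    and "t \<in> carrier (tensor K M N)"
    and "\<And>m n. m \<in> carrier M \<Longrightarrow> n \<in> carrier N \<Longrightarrow> \<beta> m n \<in> carrier P"
  shows "\<phi> (tensor_lift K P \<beta> t) = tensor_lift K Q (\<lambda>m n. \<phi> (\<beta> m n)) t"
proof -
  interpret P: module K P by fact
  interpret Q: module K Q by fact
  let ?x = "SOME x. x \<in> t"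
  note \<phi> = linear_mapD[OF assms(5)]
  have x: "?x p \<in> carrier K" "finite {p. ?x p \<noteq> \<zero>\<^bsub>K\<^esub>}"
    "?x p \<noteq> \<zero>\<^bsub>K\<^esub> \<Longrightarrow> \<beta> (fst p) (snd p) \<in> carrier P" for p
    using free_moduleD[OF tensor_representative(1)[OF assms(1,2,6)]] assms(7)
    by (blast, blast, metis mem_Times_iff)
  show ?thesis
    unfolding tensor_lift_eq_free_lift free_lift_def
    by (subst linear_map_finsum[OF assms(3-5) x(2)];
      (intro Q.finsum_cong' refl Pi_I)?; simp add: x \<phi>)
qed

text \<open>The tensor \<open>t\<close>, and with it the chosen representative, is the same for all
  \<open>l\<close>, so linearity can be checked in each term separately.\<close>

lemma linear_map_tensor_lift_param:
  assumes "module K M" "module K N" "module K P" "module K L" "t \<in> carrier (tensor K M N)"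
    and "\<And>m n. m \<in> carrier M \<Longrightarrow> n \<in> carrier N \<Longrightarrow> linear_map K L P (\<lambda>l. \<beta> l m n)"
  shows "linear_map K L P (\<lambda>l. tensor_lift K P (\<beta> l) t)"
proof (rule linear_mapI)
  interpret P: module K P by fact
  interpret L: module K L by fact
  let ?x = "SOME x. x \<in> t"
  have x: "?x p \<in> carrier K" "finite {p. ?x p \<noteq> \<zero>\<^bsub>K\<^esub>}"
    "?x p \<noteq> \<zero>\<^bsub>K\<^esub> \<Longrightarrow> linear_map K L P (\<lambda>l. \<beta> l (fst p) (snd p))" for p
    using free_moduleD[OF tensor_representative(1)[OF assms(1,2,5)]] assms(6)
    by (blast, blast, metis mem_Times_iff)
  note \<beta> = linear_mapD[OF x(3)]
  show "tensor_lift K P (\<beta> l) t \<in> carrier P" if "l \<in> carrier L" for l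
    using that linear_map_closed[OF assms(6)] by (intro tensor_lift_closed[OF assms(1-3,5)])
  show "tensor_lift K P (\<beta> (l \<oplus>\<^bsub>L\<^esub> l')) t = tensor_lift K P (\<beta> l) t \<oplus>\<^bsub>P\<^esub> tensor_lift K P (\<beta> l') t"
    if "l \<in> carrier L" "l' \<in> carrier L" for l l'
    unfolding tensor_lift_eq_free_lift free_lift_def using that
    by (subst P.finsum_addf[symmetric];
      (intro P.finsum_cong' refl Pi_I)?; simp add: x(1) \<beta> P.smult_r_distr)
  show "tensor_lift K P (\<beta> (c \<odot>\<^bsub>L\<^esub> l)) t = c \<odot>\<^bsub>P\<^esub> tensor_lift K P (\<beta> l) t"
    if "c \<in> carrier K" "l \<in> carrier L" for c l
    unfolding tensor_lift_eq_free_lift free_lift_def using that x(2)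
    by (subst P.finsum_smult_ldistr;
      (intro P.finsum_cong' refl Pi_I)?; simp add: x(1) \<beta> P.smult_assoc1[symmetric] P.R.m_comm)
qed


section \<open>The integral\<close>

theorem mainTheorem8:
  fixes K :: "('k, 'z) ring_scheme"
    and B :: "('k, 'b, 'p) bialg_scheme"
    and S :: "'b \<Rightarrow> 'b"
    and H :: "('k, 'h, 'q) bialg_scheme"
    and Y :: "('k, 'b, 'h) yd_structure"
    and \<Lambda> :: "('h \<times> 'b \<Rightarrow> 'k) set \<Rightarrow> 'k"
    and a :: 'h and b :: 'b
  assumes "field K"
    and "hopf_algebra K B S"
    and "bij_betw S (carrier B) (carrier B)"
    and "braided_hopf_algebra K B S H Y"
    and "\<Lambda> \<in> left_integrals K (bosonization K H Y B)"
    and "\<Lambda> \<noteq> zero_functional K (bosonization K H Y B)"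
    and "a \<in> carrier H" and "b \<in> carrier B"
    and "\<Lambda> (tens K H B a b) \<noteq> \<zero>\<^bsub>K\<^esub>"
  shows "(\<lambda>h\<in>carrier H. \<Lambda> (tens K H B h b)) \<in> left_integrals K H \<and>
    (\<lambda>h\<in>carrier H. \<Lambda> (tens K H B h b)) \<noteq> zero_functional K H"
proof -
  let ?T = "tensor K H B" and ?k = "base_module K" and ?A = "bosonization K H Y B"
  let ?P = "tensor K ?T ?T"
  interpret K: field K by fact
  note K = K.is_cring
  have B: "bialgebra K B" "assoc_algebra K B" "coalgebra K B"
    using assms(2) by (auto simp: hopf_algebra_def bialgebra_def)
  have H: "yd_module K B S H Y" "assoc_algebra K H" "coalgebra K H"
    using assms(4) by (auto simp: braided_hopf_algebra_def braided_bialgebra_def Let_def)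
  have modB: "module K B" and modH: "module K H"
    using B H by (auto simp: coalgebra_def)
  interpret B: module K B by (rule modB)
  interpret H: module K H by (rule modH)
  interpret Br: ring B using B(2) by (simp add: assoc_algebra_def)
  interpret Hr: ring H using H(2) by (simp add: assoc_algebra_def)
  note modT = module_tensor[OF modH modB] and modk = module_base_module[OF K]
  note modP = module_tensor[OF modT modT]
  interpret T: module K ?T by (rule modT)

  have \<epsilon>: "linear_map K B ?k (counit B)" and \<Delta>B: "linear_map K B (tensor K B B) (comult B)"
    and \<Delta>H: "linear_map K H (tensor K H H) (comult H)"
    using B H by (auto simp: coalgebra_def)
  have \<rho>: "linear_map K H (tensor K B H) (coact Y)"
    using H(1) by (auto simp: yd_module_def left_comodule_over_def)
  have counit_B: "tensor_lift K B (\<lambda>x\<^sub>1 x\<^sub>2. counit B x\<^sub>1 \<odot>\<^bsub>B\<^esub> x\<^sub>2) (comult B x) = x"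
    if "x \<in> carrier B" for x
    using B(3) that by (auto simp: coalgebra_def)
  have counit_coact: "tensor_lift K H (\<lambda>u n. counit B u \<odot>\<^bsub>H\<^esub> n) (coact Y x) = x"
    if "x \<in> carrier H" for x
    using H(1) that by (auto simp: yd_module_def left_comodule_over_def)
  have \<epsilon>_mult: "counit B (x \<otimes>\<^bsub>B\<^esub> y) = counit B x \<otimes>\<^bsub>K\<^esub> counit B y"
    if "x \<in> carrier B" "y \<in> carrier B" for x y
    using B(1) that by (auto simp: bialgebra_def)
  have \<epsilon>_one: "counit B \<one>\<^bsub>B\<^esub> = \<one>\<^bsub>K\<^esub>"
    using B(1) by (auto simp: bialgebra_def)
  note \<epsilon>_closed [simp] = linear_map_closed[OF \<epsilon>, simplified]
  note \<Delta>B_closed = linear_map_closed[OF \<Delta>B] and \<Delta>H_closed = linear_map_closed[OF \<Delta>H]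
    and \<rho>_closed = linear_map_closed[OF \<rho>]
  have tens_T [simp]: "tens K H B h c \<in> carrier ?T" if "h \<in> carrier H" "c \<in> carrier B" for h c
    using that by (rule tens_closed[OF modH])
  note bil_tens = bilinear_map_tens[OF modH modB]

  \<comment> \<open>The bosonization copies carrier, addition and scalars from \<open>?T\<close>, so
    the linear algebra can stay on \<open>?T\<close> throughout.\<close>
  have linear_A: "linear_map K ?A ?k f \<longleftrightarrow> linear_map K ?T ?k f" for f
    by (simp add: linear_map_def bosonization_def Let_def)
  have carrier_A: "carrier ?A = carrier ?T" and one_A: "\<one>\<^bsub>?A\<^esub> = tens K H B \<one>\<^bsub>H\<^esub> \<one>\<^bsub>B\<^esub>"
    by (simp_all add: bosonization_def Let_def)
  have \<Lambda>: "linear_map K ?T ?k \<Lambda>"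
    and \<Lambda>_int: "\<And>G. G \<in> dual_space K ?A \<Longrightarrow>
      convolution K ?A G \<Lambda> = (\<lambda>x\<in>carrier ?A. G \<one>\<^bsub>?A\<^esub> \<otimes>\<^bsub>K\<^esub> \<Lambda> x)"
    using assms(5) by (auto simp: left_integrals_def dual_space_def linear_A)
  note \<Lambda>_closed [simp] = linear_map_closed[OF \<Lambda>, simplified]
  have \<Lambda>_left: "linear_map K H ?k (\<lambda>h. \<Lambda> (tens K H B h c))" if "c \<in> carrier B" for c
    using linear_map_comp[OF bilinear_map_left[OF bil_tens that] \<Lambda>] .
  have \<Lambda>_right: "linear_map K B ?k (\<lambda>c. \<Lambda> (tens K H B h c))" if "h \<in> carrier H" for h
    using linear_map_comp[OF bilinear_map_right[OF bil_tens that] \<Lambda>] .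
  let ?f = "\<lambda>h\<in>carrier H. \<Lambda> (tens K H B h b)"

  have f: "linear_map K H ?k ?f"
    by (rule linear_map_cong[OF modH \<Lambda>_left[OF assms(8)]]) simp
  have "convolution K H g ?f = (\<lambda>x\<in>carrier H. g \<one>\<^bsub>H\<^esub> \<otimes>\<^bsub>K\<^esub> ?f x)" if "g \<in> dual_space K H" for g
  proof -
    have g: "linear_map K H ?k g"
      using that by (simp add: dual_space_def)
    note g_closed [simp] = linear_map_closed[OF g, simplified]
    have bil_G: "bilinear_map K H B ?k (\<lambda>h c. g h \<otimes>\<^bsub>K\<^esub> counit B c)"
      by (rule bilinear_map_product[OF K g \<epsilon>])
    \<comment> \<open>The test functional of the overview, cut off outside the carrier because
      \<open>dual_space\<close> contains extensional functions only.\<close>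
    define G where "G = (\<lambda>t\<in>carrier ?T. tensor_lift K ?k (\<lambda>h c. g h \<otimes>\<^bsub>K\<^esub> counit B c) t)"
    have G: "linear_map K ?T ?k G"
      by (rule linear_map_cong[OF modT linear_map_tensor_lift[OF modH modB modk bil_G]])
        (simp add: G_def)
    have G_tens: "G (tens K H B h c) = g h \<otimes>\<^bsub>K\<^esub> counit B c" if "h \<in> carrier H" "c \<in> carrier B" for h c
      using that by (simp add: G_def tensor_lift_tens[OF modH modB modk bil_G])
    have "G \<in> dual_space K ?A"
      using G by (simp add: dual_space_def linear_A carrier_A) (simp add: G_def)
    note conv = \<Lambda>_int[OF this]
    have bil_\<Phi>: "bilinear_map K ?T ?T ?k (\<lambda>s t. G s \<otimes>\<^bsub>K\<^esub> \<Lambda> t)"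
      by (rule bilinear_map_product[OF K G \<Lambda>])
    \<comment> \<open>On the carrier, the convolution of \<open>G\<close> and \<Lambda> is \<Phi>
      after the comultiplication. Being linear, \<Phi> can be pushed into that comultiplication one
      level at a time.\<close>
    define \<Phi> where "\<Phi> = tensor_lift K ?k (\<lambda>s t. G s \<otimes>\<^bsub>K\<^esub> \<Lambda> t)"
    have \<Phi>: "linear_map K ?P ?k \<Phi>"
      unfolding \<Phi>_def by (rule linear_map_tensor_lift[OF modT modT modk bil_\<Phi>])
    note \<Phi>_lift = linear_map_of_tensor_lift[OF _ _ modP modk \<Phi>]

    \<comment> \<open>The innermost summand of the comultiplication. From here outwards,
      \<open>\<beta>\<^sub>3\<close> sums over \<open>comult B\<close>,
      \<open>\<beta>\<^sub>2\<close> over the coaction and \<open>\<beta>\<^sub>1\<close> over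
      \<open>comult H\<close>.\<close>
    define \<tau> where "\<tau> = (\<lambda>h\<^sub>1 u n b\<^sub>1 b\<^sub>2. tens K ?T ?T (tens K H B h\<^sub>1 (u \<otimes>\<^bsub>B\<^esub> b\<^sub>1)) (tens K H B n b\<^sub>2))"
    have \<tau>_closed: "\<tau> h\<^sub>1 u n b\<^sub>1 b\<^sub>2 \<in> carrier ?P"
      if "h\<^sub>1 \<in> carrier H" "u \<in> carrier B" "n \<in> carrier H" "b\<^sub>1 \<in> carrier B" "b\<^sub>2 \<in> carrier B" for h\<^sub>1 u n b\<^sub>1 b\<^sub>2
      unfolding \<tau>_def using that by (intro tens_closed[OF modT]) simp_all
    \<comment> \<open>Multiplicativity of the counit separates \<open>u\<close> from
      \<open>b\<^sub>1\<close>. The scalar from \<open>b\<^sub>1\<close> is moved inside \<Lambda>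
      next to \<open>b\<^sub>2\<close>, in the shape of the counit axiom of B.\<close>
    have \<Phi>_\<tau>: "\<Phi> (\<tau> h\<^sub>1 u n b\<^sub>1 b\<^sub>2) = (g h\<^sub>1 \<otimes>\<^bsub>K\<^esub> counit B u) \<otimes>\<^bsub>K\<^esub> \<Lambda> (tens K H B n (counit B b\<^sub>1 \<odot>\<^bsub>B\<^esub> b\<^sub>2))"
      if "h\<^sub>1 \<in> carrier H" "u \<in> carrier B" "n \<in> carrier H" "b\<^sub>1 \<in> carrier B" "b\<^sub>2 \<in> carrier B" for h\<^sub>1 u n b\<^sub>1 b\<^sub>2
    proof -
      have "\<Phi> (\<tau> h\<^sub>1 u n b\<^sub>1 b\<^sub>2) = G (tens K H B h\<^sub>1 (u \<otimes>\<^bsub>B\<^esub> b\<^sub>1)) \<otimes>\<^bsub>K\<^esub> \<Lambda> (tens K H B n b\<^sub>2)"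
        unfolding \<Phi>_def \<tau>_def using that
        by (intro tensor_lift_tens[OF modT modT modk bil_\<Phi>]) simp_all
      also have "\<dots> = (g h\<^sub>1 \<otimes>\<^bsub>K\<^esub> counit B u) \<otimes>\<^bsub>K\<^esub> (counit B b\<^sub>1 \<otimes>\<^bsub>K\<^esub> \<Lambda> (tens K H B n b\<^sub>2))"
        using that by (simp add: G_tens \<epsilon>_mult K.m_assoc)
      finally show ?thesis
        using that by (simp add: linear_map_smult[OF \<Lambda>_right])
    qed
    define \<beta>\<^sub>3 where "\<beta>\<^sub>3 = (\<lambda>c h\<^sub>1 u n. tensor_lift K ?P (\<tau> h\<^sub>1 u n) (comult B c))"
    have \<beta>\<^sub>3_closed: "\<beta>\<^sub>3 c h\<^sub>1 u n \<in> carrier ?P"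
      if "c \<in> carrier B" "h\<^sub>1 \<in> carrier H" "u \<in> carrier B" "n \<in> carrier H" for c h\<^sub>1 u n
      unfolding \<beta>\<^sub>3_def using that \<tau>_closed
      by (intro tensor_lift_closed[OF modB modB modP \<Delta>B_closed])
    have \<Phi>_\<beta>\<^sub>3: "\<Phi> (\<beta>\<^sub>3 c h\<^sub>1 u n) = g h\<^sub>1 \<otimes>\<^bsub>K\<^esub> \<Lambda> (tens K H B (counit B u \<odot>\<^bsub>H\<^esub> n) c)"
      if *: "c \<in> carrier B" "h\<^sub>1 \<in> carrier H" "u \<in> carrier B" "n \<in> carrier H" for c h\<^sub>1 u n
    proof -
      \<comment> \<open>Everything that does not vary in the sum over \<open>comult B c\<close> is
        packed into one functional. Pulling it out of the sum leaves exactly the left-hand side of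
        the counit axiom. Afterwards the scalar from \<open>u\<close> moves to the H-factor, ready
        for the coaction.\<close>
      let ?\<chi> = "\<lambda>x. (g h\<^sub>1 \<otimes>\<^bsub>K\<^esub> counit B u) \<otimes>\<^bsub>K\<^esub> \<Lambda> (tens K H B n x)"
      have \<chi>: "linear_map K B ?k ?\<chi>"
        using * by (intro linear_map_scale[OF K \<Lambda>_right]) simp_all
      have "\<Phi> (\<beta>\<^sub>3 c h\<^sub>1 u n) = tensor_lift K ?k (\<lambda>b\<^sub>1 b\<^sub>2. \<Phi> (\<tau> h\<^sub>1 u n b\<^sub>1 b\<^sub>2)) (comult B c)"
        unfolding \<beta>\<^sub>3_def using * by (intro \<Phi>_lift[OF modB modB] \<Delta>B_closed \<tau>_closed)
      also have "\<dots> = tensor_lift K ?k (\<lambda>b\<^sub>1 b\<^sub>2. ?\<chi> (counit B b\<^sub>1 \<odot>\<^bsub>B\<^esub> b\<^sub>2)) (comult B c)"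
        using * by (intro tensor_lift_cong[OF modB modB modk \<Delta>B_closed] \<Phi>_\<tau>) simp_all
      also have "\<dots> = ?\<chi> (tensor_lift K B (\<lambda>b\<^sub>1 b\<^sub>2. counit B b\<^sub>1 \<odot>\<^bsub>B\<^esub> b\<^sub>2) (comult B c))"
        using * by (intro linear_map_of_tensor_lift[OF modB modB modB modk \<chi>, symmetric] \<Delta>B_closed) simp_all
      also have "\<dots> = g h\<^sub>1 \<otimes>\<^bsub>K\<^esub> \<Lambda> (tens K H B (counit B u \<odot>\<^bsub>H\<^esub> n) c)"
        using * by (simp add: counit_B linear_map_smult[OF \<Lambda>_left] K.m_assoc)
      finally show ?thesis .
    qed
    define \<beta>\<^sub>2 where "\<beta>\<^sub>2 = (\<lambda>c h\<^sub>1 h\<^sub>2. tensor_lift K ?P (\<beta>\<^sub>3 c h\<^sub>1) (coact Y h\<^sub>2))"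
    have \<beta>\<^sub>2_closed: "\<beta>\<^sub>2 c h\<^sub>1 h\<^sub>2 \<in> carrier ?P"
      if "c \<in> carrier B" "h\<^sub>1 \<in> carrier H" "h\<^sub>2 \<in> carrier H" for c h\<^sub>1 h\<^sub>2
      unfolding \<beta>\<^sub>2_def using that \<beta>\<^sub>3_closed
      by (intro tensor_lift_closed[OF modB modH modP \<rho>_closed])
    have \<Phi>_\<beta>\<^sub>2: "\<Phi> (\<beta>\<^sub>2 c h\<^sub>1 h\<^sub>2) = g h\<^sub>1 \<otimes>\<^bsub>K\<^esub> \<Lambda> (tens K H B h\<^sub>2 c)"
      if *: "c \<in> carrier B" "h\<^sub>1 \<in> carrier H" "h\<^sub>2 \<in> carrier H" for c h\<^sub>1 h\<^sub>2
    proof -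
      \<comment> \<open>The same manoeuvre for the sum over the coaction: what remains inside is the
        counit axiom of the comodule, which returns \<open>h\<^sub>2\<close>.\<close>
      let ?\<psi> = "\<lambda>n. g h\<^sub>1 \<otimes>\<^bsub>K\<^esub> \<Lambda> (tens K H B n c)"
      have \<psi>: "linear_map K H ?k ?\<psi>"
        using * by (intro linear_map_scale[OF K \<Lambda>_left]) simp_all
      have "\<Phi> (\<beta>\<^sub>2 c h\<^sub>1 h\<^sub>2) = tensor_lift K ?k (\<lambda>u n. \<Phi> (\<beta>\<^sub>3 c h\<^sub>1 u n)) (coact Y h\<^sub>2)"
        unfolding \<beta>\<^sub>2_def using * by (intro \<Phi>_lift[OF modB modH] \<rho>_closed \<beta>\<^sub>3_closed)
      also have "\<dots> = tensor_lift K ?k (\<lambda>u n. ?\<psi> (counit B u \<odot>\<^bsub>H\<^esub> n)) (coact Y h\<^sub>2)"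
        using * by (intro tensor_lift_cong[OF modB modH modk \<rho>_closed] \<Phi>_\<beta>\<^sub>3) simp_all
      also have "\<dots> = ?\<psi> (tensor_lift K H (\<lambda>u n. counit B u \<odot>\<^bsub>H\<^esub> n) (coact Y h\<^sub>2))"
        using * by (intro linear_map_of_tensor_lift[OF modB modH modH modk \<psi>, symmetric] \<rho>_closed) simp_all
      finally show ?thesis
        using * by (simp add: counit_coact)
    qed
    define \<beta>\<^sub>1 where "\<beta>\<^sub>1 = (\<lambda>h c. tensor_lift K ?P (\<beta>\<^sub>2 c) (comult H h))"
    have \<beta>\<^sub>1_closed: "\<beta>\<^sub>1 h c \<in> carrier ?P" if "h \<in> carrier H" "c \<in> carrier B" for h c
      unfolding \<beta>\<^sub>1_def using that \<beta>\<^sub>2_closed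
      by (intro tensor_lift_closed[OF modH modH modP \<Delta>H_closed])
    \<comment> \<open>The convolution of \<open>g\<close> with \<Lambda> at the B-factor
      \<open>c\<close>, evaluated at \<open>h\<close>. The factor stays variable because the
      representative chosen for \<open>tens K H B h b\<close> may involve pairs other than
      \<open>(h, b)\<close>.\<close>
    define \<gamma> where "\<gamma> = (\<lambda>h c. tensor_lift K ?k (\<lambda>h\<^sub>1 h\<^sub>2. g h\<^sub>1 \<otimes>\<^bsub>K\<^esub> \<Lambda> (tens K H B h\<^sub>2 c)) (comult H h))"
    have \<Phi>_\<beta>\<^sub>1: "\<Phi> (\<beta>\<^sub>1 h c) = \<gamma> h c" if *: "h \<in> carrier H" "c \<in> carrier B" for h c
    proof -
      have "\<Phi> (\<beta>\<^sub>1 h c) = tensor_lift K ?k (\<lambda>h\<^sub>1 h\<^sub>2. \<Phi> (\<beta>\<^sub>2 c h\<^sub>1 h\<^sub>2)) (comult H h)"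
        unfolding \<beta>\<^sub>1_def using * by (intro \<Phi>_lift[OF modH modH] \<Delta>H_closed \<beta>\<^sub>2_closed)
      also have "\<dots> = \<gamma> h c"
        unfolding \<gamma>_def using *
        by (intro tensor_lift_cong[OF modH modH modk \<Delta>H_closed] \<Phi>_\<beta>\<^sub>2) simp_all
      finally show ?thesis .
    qed
    \<comment> \<open>The two variables enter differently: \<open>c\<close> occurs in the summand
      over a fixed tensor, whereas \<open>h\<close> occurs only through the linear map
      \<open>comult H\<close>.\<close>
    have bil_\<gamma>: "bilinear_map K H B ?k \<gamma>"
    proof (rule bilinear_mapI)
      show "linear_map K B ?k (\<gamma> h)" if "h \<in> carrier H" for h
        unfolding \<gamma>_def using that
        by (intro linear_map_tensor_lift_param[OF modH modH modk modB] \<Delta>H_closed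
            linear_map_scale[OF K \<Lambda>_right]) simp_all
      show "linear_map K H ?k (\<lambda>h. \<gamma> h c)" if "c \<in> carrier B" for c
        unfolding \<gamma>_def using that
        by (intro linear_map_comp[OF \<Delta>H] linear_map_tensor_lift[OF modH modH modk]
            bilinear_map_product[OF K g \<Lambda>_left])
    qed
    have \<gamma>: "\<gamma> h b = g \<one>\<^bsub>H\<^esub> \<otimes>\<^bsub>K\<^esub> \<Lambda> (tens K H B h b)" if h: "h \<in> carrier H" for h
    proof -
      have t: "tens K H B h b \<in> carrier ?T"
        using h assms(8) by simp
      have "comult ?A (tens K H B h b) = tensor_lift K ?P \<beta>\<^sub>1 (tens K H B h b)"
        by (simp add: bosonization_def Let_def \<beta>\<^sub>1_def \<beta>\<^sub>2_def \<beta>\<^sub>3_def \<tau>_def)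
      \<comment> \<open>\<Phi> goes inside before the outer lift is evaluated: the bilinearity
        established is that of \<gamma>, and \<open>\<beta>\<^sub>1\<close> turns into \<gamma> only
        under \<Phi>.\<close>
      then have "\<Phi> (comult ?A (tens K H B h b)) = tensor_lift K ?k (\<lambda>h c. \<Phi> (\<beta>\<^sub>1 h c)) (tens K H B h b)"
        using \<Phi>_lift[OF modH modB t] \<beta>\<^sub>1_closed by simp
      also have "\<dots> = tensor_lift K ?k \<gamma> (tens K H B h b)"
        using bilinear_map_closed[OF bil_\<gamma>]
        by (intro tensor_lift_cong[OF modH modB modk t] \<Phi>_\<beta>\<^sub>1)
      also have "\<dots> = \<gamma> h b"
        using h assms(8) by (intro tensor_lift_tens[OF modH modB modk bil_\<gamma>])
      finally have "\<gamma> h b = convolution K ?A G \<Lambda> (tens K H B h b)"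
        using t by (simp add: convolution_def carrier_A \<Phi>_def)
      then show ?thesis
        using t by (simp add: conv carrier_A one_A G_tens \<epsilon>_one)
    qed
    show ?thesis
    proof (rule extensionalityI[of _ "carrier H"])
      fix h assume h: "h \<in> carrier H"
      have "convolution K H g ?f h = \<gamma> h b"
        unfolding \<gamma>_def using h assms(8)
        by (simp add: convolution_def)
          \<comment> \<open>The convolution uses the restricted functional \<open>?f\<close> and
            \<gamma> the unrestricted one; they agree on the carrier, which contains every factor in
            the representative.\<close>
          (intro tensor_lift_cong[OF modH modH modk \<Delta>H_closed], simp_all)
      then show "convolution K H g ?f h = (\<lambda>x\<in>carrier H. g \<one>\<^bsub>H\<^esub> \<otimes>\<^bsub>K\<^esub> ?f x) h"
        using h by (simp add: \<gamma>)
    qed (simp_all add: convolution_def)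
  qed
  with f have "?f \<in> left_integrals K H"
    by (simp add: left_integrals_def dual_space_def)
  moreover have "?f a \<noteq> zero_functional K H a"
    using assms(7,9) by (simp add: zero_functional_def)
  ultimately show ?thesis
    by metis
qed

end
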